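(* Let $n$ and $q$ be integers with $0\le q\le n-4$. Among all trees on $n$ vertices with exactly $q$ vertices of degree two, $BS_{n,n-1-q}$ is the unique tree having maximal Harary index.
   Context: The Harary index of a connected graph $G$ is $H(G)=\sum_{\{x,y\}\subseteq V(G),\,x\ne y}\frac{1}{d(x,y)}$, $d$ the shortest-path distance. For $2\le k\le n-1$, $BS_{n,k}$ is the balanced starlike tree: the tree on $n$ vertices consisting of a vertex $v$ such that removing $v$ leaves $k$ disjoint paths with $n_1,\dots,n_k$ vertices ($n_1+\dots+n_k=n-1$, $|n_i-n_j|\le 1$ for all $i,j$), $v$ being adjacent to an endvertex of each path. *)

theory Defs
  imports "Graph_Theory.Graph_Theory" Complex_Main
begin

text \<open>
  A finite simple graph is a \<open>pair_graph\<close>, i.e. a finite loop-free symmetric digraph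
  without parallel arcs: an edge \<open>{x,y}\<close> is the pair of arcs \<open>(x,y)\<close>, \<open>(y,x)\<close>, and the
  degree of a vertex is its out-degree.
\<close>

text \<open>
  The constant \<open>Digraph_Component.tree\<close> is unsuitable here: in a symmetric digraph the closed
  walk \<open>(x,y), (y,x)\<close> along a single edge already is a \<open>cycle\<close>. The cycles of the
  undirected graph are those with at least three arcs.
\<close>

definition undirected_tree :: "'a pair_pre_digraph \<Rightarrow> bool" where
  "undirected_tree G \<longleftrightarrow>
     pair_graph G \<and> Digraph_Component.connected (with_proj G) \<and>
     \<not> (\<exists>p. pre_digraph.cycle (with_proj G) p \<and> 3 \<le> length p)"

definition num_degree_two :: "'a pair_pre_digraph \<Rightarrow> nat" where
  "num_degree_two G = card {v \<in> pverts G. out_degree (with_proj G) v = 2}"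

definition graph_dist :: "'a pair_pre_digraph \<Rightarrow> 'a \<Rightarrow> 'a \<Rightarrow> real" where
  "graph_dist G x y = real_of_ereal (wf_digraph.\<mu> (with_proj G) (\<lambda>_. 1) x y)"

text \<open>
  The sum runs over ordered pairs, so every unordered pair \<open>{x,y}\<close> is counted twice;
  hence the factor 1/2.
\<close>

definition harary :: "'a pair_pre_digraph \<Rightarrow> real" where
  "harary G =
     (\<Sum>(x, y) \<in> {(x, y). x \<in> pverts G \<and> y \<in> pverts G \<and> x \<noteq> y}. 1 / graph_dist G x y) / 2"

text \<open>
  The starlike tree with \<open>k\<close> branches, the \<open>i\<close>-th one a path with \<open>l i\<close> vertices (\<open>i < k\<close>):
  \<open>None\<close> is the centre, and \<open>Some (i, 0), \<dots>, Some (i, l i - 1)\<close> is the \<open>i\<close>-th path,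
  with the endvertex \<open>Some (i, 0)\<close> adjacent to the centre.
\<close>

definition starlike_arcs :: "nat \<Rightarrow> (nat \<Rightarrow> nat) \<Rightarrow> ((nat \<times> nat) option) rel" where
  "starlike_arcs k l =
     {(None, Some (i, 0)) | i. i < k \<and> 0 < l i} \<union>
     {(Some (i, j), Some (i, Suc j)) | i j. i < k \<and> Suc j < l i}"

definition starlike :: "nat \<Rightarrow> (nat \<Rightarrow> nat) \<Rightarrow> ((nat \<times> nat) option) pair_pre_digraph" where
  "starlike k l =
     \<lparr> pverts = insert None (Some ` {(i, j). i < k \<and> j < l i}),
       parcs = starlike_arcs k l \<union> (starlike_arcs k l)\<inverse> \<rparr>"

definition branch_size :: "nat \<Rightarrow> nat \<Rightarrow> nat \<Rightarrow> nat" where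
  "branch_size n k i = (n - 1) div k + (if i < (n - 1) mod k then 1 else 0)"

definition BS :: "nat \<Rightarrow> nat \<Rightarrow> ((nat \<times> nat) option) pair_pre_digraph" where
  "BS n k = starlike k (branch_size n k)"

text \<open>
  For \<open>1 \<le> k \<le> n - 1\<close> the branch sizes are positive, sum up to \<open>n - 1\<close> and differ by at
  most one; up to order these properties determine them.
\<close>

lemma branch_size_pos:
  assumes "1 \<le> k" "k \<le> n - 1"
  shows "0 < branch_size n k i"
  using assms by (simp add: branch_size_def div_greater_zero_iff)

lemma sum_branch_size:
  assumes "1 \<le> k"
  shows "(\<Sum>i<k. branch_size n k i) = n - 1"
proof -
  have "{i \<in> {..<k}. i < (n - 1) mod k} = {..<(n - 1) mod k}"
    using assms by (auto intro: less_trans[OF _ mod_less_divisor])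
  then have "(\<Sum>i<k. if i < (n - 1) mod k then 1 else (0::nat)) = (n - 1) mod k"
    by (simp flip: sum.inter_filter)
  then show ?thesis
    by (simp add: branch_size_def sum.distrib)
qed

lemma branch_size_balanced: "\<bar>int (branch_size n k i) - int (branch_size n k j)\<bar> \<le> 1"
  by (simp add: branch_size_def)

end

theory Submission
  imports Defs
begin

text \<open>
  In a tree on \<open>n\<close> vertices let \<open>B\<^sub>j(x)\<close> be the ball of radius \<open>j\<close> around \<open>x\<close>, and let \<open>near\<^sub>j\<close> be
  the number of ordered pairs at distance at most \<open>j\<close>. Because exactly one neighbour of \<open>y \<noteq> x\<close> is
  closer to \<open>x\<close>, we have \<open>|B\<^sub>j\<^sub>+\<^sub>1(x)| = 2 + (\<Sum>y \<in> B\<^sub>j(x). deg y - 1)\<close>. Summing over \<open>x\<close> gives two facts.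

  First, \<open>near\<^sub>j\<^sub>+\<^sub>1 - near\<^sub>j = 2n + (\<Sum>y. (deg y - 2) |B\<^sub>j(y)|)\<close>. With at most \<open>k\<close> leaves, balls have at
  most \<open>1 + kj\<close> elements and those around leaves at least \<open>j + 1\<close>, which bounds the increments; \<open>BS\<close>
  attains the bound as long as \<open>j + 1\<close> is at most the length \<open>m\<close> of its longest branch.

  Second, the number of pairs at distance more than \<open>j + 2\<close> is the sum of \<open>(deg x - 1) (deg y - 1)\<close>
  over the pairs at distance more than \<open>j\<close>, hence at least the number of such pairs in the tree
  without its leaves. Removing \<open>k\<close> vertices including all leaves and using that \<open>BS\<^sub>n\<^sub>,\<^sub>k\<close> without its
  leaves is \<open>BS\<^sub>n\<^sub>-\<^sub>k\<^sub>,\<^sub>k\<close>, where for \<open>j + 2 > m\<close> equality holds, induction on \<open>n\<close> covers the distances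
  beyond \<open>m\<close>.

  So \<open>BS\<close> maximises every \<open>near\<^sub>j\<close> among the trees with at most \<open>k\<close> leaves, and the Harary index is a
  positive combination of the \<open>near\<^sub>j\<close>. A tree with \<open>q\<close> vertices of degree two has at most
  \<open>k = n - 1 - q\<close> leaves. If all \<open>near\<^sub>j\<close> agree with those of \<open>BS\<close>, then \<open>near\<^sub>2\<close> yields a vertex of
  degree \<open>k\<close>, \<open>near\<^sub>m\<close> shows that all its branches have at least \<open>m - 1\<close> vertices, and \<open>near\<^sub>m\<^sub>+\<^sub>1\<close> that
  they have at most \<open>m\<close>.
\<close>

section \<open>Finite trees as metric spaces\<close>

definition nbrs :: "'a set \<Rightarrow> ('a \<Rightarrow> 'a \<Rightarrow> nat) \<Rightarrow> 'a \<Rightarrow> 'a set" where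
  "nbrs V d x = {z \<in> V. d x z = 1}"

definition deg :: "'a set \<Rightarrow> ('a \<Rightarrow> 'a \<Rightarrow> nat) \<Rightarrow> 'a \<Rightarrow> nat" where
  "deg V d x = card (nbrs V d x)"

definition disc :: "'a set \<Rightarrow> ('a \<Rightarrow> 'a \<Rightarrow> nat) \<Rightarrow> 'a \<Rightarrow> nat \<Rightarrow> 'a set" where
  "disc V d x j = {y \<in> V. d x y \<le> j}"

text \<open>The bound \<open>\<le> 1\<close> instead of equality makes the vertex of a one-vertex
  tree a leaf, so that every nonempty tree has one.\<close>

definition leaves :: "'a set \<Rightarrow> ('a \<Rightarrow> 'a \<Rightarrow> nat) \<Rightarrow> 'a set" where
  "leaves V d = {x \<in> V. deg V d x \<le> 1}"

definition near :: "'a set \<Rightarrow> ('a \<Rightarrow> 'a \<Rightarrow> nat) \<Rightarrow> nat \<Rightarrow> nat" where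
  "near V d j = card {(x, y) \<in> V \<times> V. d x y \<le> j}"

definition far :: "'a set \<Rightarrow> ('a \<Rightarrow> 'a \<Rightarrow> nat) \<Rightarrow> nat \<Rightarrow> nat" where
  "far V d j = card {(x, y) \<in> V \<times> V. j < d x y}"

text \<open>For \<open>y \<noteq> x\<close> exactly one neighbour of \<open>y\<close>, its parent
  seen from \<open>x\<close>, is closer to \<open>x\<close>, and all others are farther. This
  captures connectedness and acyclicity without walks, and a subtree is simply the same
  \<open>d\<close> on a smaller set.\<close>

locale tree_metric =
  fixes V :: "'a set" and d :: "'a \<Rightarrow> 'a \<Rightarrow> nat"
  assumes finite_V: "finite V"
    and dist_eq_0_iff: "\<lbrakk>x \<in> V; y \<in> V\<rbrakk> \<Longrightarrow> d x y = 0 \<longleftrightarrow> x = y"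
    and dist_commute: "\<lbrakk>x \<in> V; y \<in> V\<rbrakk> \<Longrightarrow> d x y = d y x"
    and parent_exists: "\<lbrakk>x \<in> V; y \<in> V; x \<noteq> y\<rbrakk> \<Longrightarrow>
      \<exists>p \<in> V. d y p = 1 \<and> d x y = Suc (d x p) \<and>
        (\<forall>z \<in> V. d y z = 1 \<and> z \<noteq> p \<longrightarrow> d x z = Suc (d x y))"
begin

lemma dist_self: "x \<in> V \<Longrightarrow> d x x = 0"
  by (simp add: dist_eq_0_iff)

lemma parentE:
  assumes "x \<in> V" "y \<in> V" "x \<noteq> y"
  obtains p where "p \<in> V" "d y p = 1" "d x y = Suc (d x p)"
    "\<And>z. z \<in> V \<Longrightarrow> d y z = 1 \<Longrightarrow> z \<noteq> p \<Longrightarrow> d x z = Suc (d x y)"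
  using parent_exists[OF assms] by blast

lemma parent_unique:
  assumes "x \<in> V" "y \<in> V" "p \<in> V" "d y p = 1" "d x y = Suc (d x p)"
    "p' \<in> V" "d y p' = 1" "d x y = Suc (d x p')"
  shows "p = p'"
proof -
  have "x \<noteq> y" using assms dist_self by (metis nat.distinct(1))
  then show ?thesis using assms parentE[of x y]
    by (metis n_not_Suc_n not_less_eq less_Suc_eq)
qed

lemma dist_nbr:
  assumes "x \<in> V" "y \<in> V" "z \<in> V" "d y z = 1"
  shows "d x z = Suc (d x y) \<or> d x y = Suc (d x z)"
proof (cases "x = y")
  case True
  then show ?thesis using assms dist_self by simp
next
  case False
  then show ?thesis using assms parentE[of x y] by metis
qed

section \<open>Growth of balls and degree sums\<close>

lemma finite_disc [simp]: "finite (disc V d x j)"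
  using finite_V by (simp add: disc_def)

lemma finite_nbrs [simp]: "finite (nbrs V d x)"
  using finite_V by (simp add: nbrs_def)

text \<open>The ball of radius \<open>j + 1\<close> without its centre is the disjoint union of the
  child sets \<open>ch y\<close> over the ball of radius \<open>j\<close>. A vertex has one child
  fewer than neighbours, except the centre; this exception and the centre itself make up the
  constant 2.\<close>

lemma card_disc_Suc:
  assumes "x \<in> V"
  shows "int (card (disc V d x (Suc j))) = 2 + (\<Sum>y\<in>disc V d x j. int (deg V d y) - 1)"
proof -
  define ch where "ch y = {z \<in> V. d y z = 1 \<and> d x z = Suc (d x y)}" for y
  have fin: "finite (ch y)" for y
    using finite_V by (simp add: ch_def)
  have card_ch: "int (card (ch y)) = int (deg V d y) - (if y = x then 0 else 1)" if "y \<in> V" for y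
  proof (cases "y = x")
    case True
    then have "ch y = nbrs V d y"
      using dist_self[OF assms] by (auto simp: ch_def nbrs_def)
    with True show ?thesis by (simp add: deg_def)
  next
    case False
    obtain p where p: "p \<in> V" "d y p = 1" "d x y = Suc (d x p)"
      "\<And>z. z \<in> V \<Longrightarrow> d y z = 1 \<Longrightarrow> z \<noteq> p \<Longrightarrow> d x z = Suc (d x y)"
      using parentE[OF assms \<open>y \<in> V\<close> False[symmetric]] by blast
    then have "nbrs V d y = insert p (ch y)" "p \<notin> ch y"
      by (auto simp: nbrs_def ch_def)
    with fin False show ?thesis by (simp add: deg_def)
  qed
  have split: "disc V d x (Suc j) = insert x (\<Union>y\<in>disc V d x j. ch y)"
  proof (intro equalityI subsetI)
    fix z assume z: "z \<in> disc V d x (Suc j)"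
    show "z \<in> insert x (\<Union>y\<in>disc V d x j. ch y)"
    proof (cases "z = x")
      case False
      with z obtain p where "p \<in> V" "d z p = 1" "d x z = Suc (d x p)"
        using parentE[of x z] assms by (auto simp: disc_def)
      with z show ?thesis
        by (auto simp: disc_def ch_def dist_commute)
    qed simp
  next
    fix z assume "z \<in> insert x (\<Union>y\<in>disc V d x j. ch y)"
    then show "z \<in> disc V d x (Suc j)"
      using assms by (auto simp: disc_def ch_def dist_self)
  qed
  have disj: "ch y \<inter> ch y' = {}" if "y \<in> V" "y' \<in> V" "y \<noteq> y'" for y y'
    using that parent_unique[OF assms] by (fastforce simp: ch_def dist_commute)
  have "x \<notin> (\<Union>y\<in>disc V d x j. ch y)"
    using dist_self[OF assms] by (auto simp: ch_def)
  then have "int (card (disc V d x (Suc j))) = 1 + int (card (\<Union>y\<in>disc V d x j. ch y))"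
    unfolding split by (simp add: fin)
  also have "card (\<Union>y\<in>disc V d x j. ch y) = (\<Sum>y\<in>disc V d x j. card (ch y))"
    by (rule card_UN_disjoint) (auto simp: fin disj disc_def finite_V)
  also have "int \<dots> = (\<Sum>y\<in>disc V d x j. int (deg V d y) - (if y = x then 0 else 1))"
    using card_ch by (simp add: disc_def)
  also have "\<dots> = (\<Sum>y\<in>disc V d x j. (int (deg V d y) - 1) + (if y = x then 1 else 0))"
    by (rule sum.cong) auto
  also have "\<dots> = (\<Sum>y\<in>disc V d x j. int (deg V d y) - 1) + 1"
    using assms by (subst sum.distrib) (simp add: disc_def dist_self finite_V)
  finally show ?thesis by simp
qed

lemma disc_eq_V: "\<exists>j. \<forall>x\<in>V. disc V d x j = V"
proof -
  have "d x y \<le> (\<Sum>x\<in>V. \<Sum>y\<in>V. d x y)" if "x \<in> V" "y \<in> V" for x y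
  proof -
    have "d x y \<le> (\<Sum>y\<in>V. d x y)" by (rule member_le_sum) (use that finite_V in auto)
    also have "\<dots> \<le> (\<Sum>x\<in>V. \<Sum>y\<in>V. d x y)"
      by (rule member_le_sum[of x V "\<lambda>x. \<Sum>y\<in>V. d x y"]) (use that finite_V in auto)
    finally show ?thesis .
  qed
  then show ?thesis by (intro exI[of _ "\<Sum>x\<in>V. \<Sum>y\<in>V. d x y"]) (auto simp: disc_def)
qed

text \<open>The edge count of a tree: \<open>card_disc_Suc\<close> is evaluated at a radius where
  the ball is already all of \<open>V\<close>.\<close>

lemma sum_deg:
  assumes "V \<noteq> {}"
  shows "(\<Sum>y\<in>V. int (deg V d y) - 1) = int (card V) - 2"
proof -
  obtain x where x: "x \<in> V" using assms by blast
  obtain j where j: "disc V d x j = V" using disc_eq_V x by blast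
  then have "disc V d x (Suc j) = V" by (force simp: disc_def)
  then show ?thesis using card_disc_Suc[OF x, of j] j by simp
qed

lemma deg_pos:
  assumes "x \<in> V" "2 \<le> card V"
  shows "1 \<le> deg V d x"
proof -
  have "V \<noteq> {x}" using assms by auto
  then obtain y where "y \<in> V" "y \<noteq> x" using assms by blast
  then obtain p where "p \<in> V" "d x p = 1" using parentE[of y x] assms by metis
  then have "nbrs V d x \<noteq> {}" by (auto simp: nbrs_def)
  then show ?thesis by (simp add: deg_def Suc_le_eq card_gt_0_iff)
qed

lemma sum_split_leaves:
  fixes f :: "'a \<Rightarrow> int"
  assumes "2 \<le> card V"
  shows "(\<Sum>y\<in>V. (int (deg V d y) - 2) * f y) =
    (\<Sum>y\<in>V - leaves V d. (int (deg V d y) - 2) * f y) - (\<Sum>y\<in>leaves V d. f y)"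
proof -
  have "leaves V d \<subseteq> V" by (auto simp: leaves_def)
  then have "(\<Sum>y\<in>V. (int (deg V d y) - 2) * f y) =
      (\<Sum>y\<in>V - leaves V d. (int (deg V d y) - 2) * f y) +
      (\<Sum>y\<in>leaves V d. (int (deg V d y) - 2) * f y)"
    by (rule sum.subset_diff) (rule finite_V)
  also have "(\<Sum>y\<in>leaves V d. (int (deg V d y) - 2) * f y) = (\<Sum>y\<in>leaves V d. - f y)"
  proof (rule sum.cong)
    fix y assume "y \<in> leaves V d"
    then have "int (deg V d y) = 1" using deg_pos[OF _ assms] by (force simp: leaves_def)
    then show "(int (deg V d y) - 2) * f y = - f y" by simp
  qed simp
  finally show ?thesis by (simp add: sum_negf)
qed

lemma sum_excess:
  assumes "2 \<le> card V"
  shows "(\<Sum>y\<in>V - leaves V d. int (deg V d y) - 2) = int (card (leaves V d)) - 2"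
proof -
  have "(\<Sum>y\<in>V. int (deg V d y) - 1) = (\<Sum>y\<in>V. (int (deg V d y) - 2) + 1)"
    by (rule sum.cong) auto
  also have "\<dots> = (\<Sum>y\<in>V. int (deg V d y) - 2) + int (card V)"
    by (subst sum.distrib) simp
  finally have "(\<Sum>y\<in>V. int (deg V d y) - 2) = -2"
    using sum_deg assms by force
  then show ?thesis using sum_split_leaves[OF assms, of "\<lambda>_. 1"] by simp
qed

lemma card_disc_step:
  assumes "x \<in> V"
  shows "int (card (disc V d x (Suc j))) =
    int (card (disc V d x j)) + 2 + (\<Sum>y\<in>disc V d x j. int (deg V d y) - 2)"
proof -
  have "(\<Sum>y\<in>disc V d x j. int (deg V d y) - 1) = (\<Sum>y\<in>disc V d x j. (int (deg V d y) - 2) + 1)"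
    by (rule sum.cong) auto
  also have "\<dots> = (\<Sum>y\<in>disc V d x j. int (deg V d y) - 2) + int (card (disc V d x j))"
    by (subst sum.distrib) simp
  finally show ?thesis using card_disc_Suc[OF assms, of j] by simp
qed

lemma two_le_card_leaves:
  assumes "2 \<le> card V"
  shows "2 \<le> card (leaves V d)"
proof -
  have "0 \<le> (\<Sum>y\<in>V - leaves V d. int (deg V d y) - 2)"
    by (rule sum_nonneg) (auto simp: leaves_def)
  then show ?thesis using sum_excess[OF assms] by simp
qed

text \<open>Leaves inside the ball contribute negatively and may be dropped; extending the sum over
  the other vertices to all of \<open>V\<close> then gives \<open>sum_excess\<close>.\<close>

lemma card_disc_step_le:
  assumes "x \<in> V" "2 \<le> card V"
  shows "card (disc V d x (Suc j)) \<le> card (disc V d x j) + card (leaves V d)"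
proof -
  have "(\<Sum>y\<in>disc V d x j. int (deg V d y) - 2) \<le> (\<Sum>y\<in>disc V d x j - leaves V d. int (deg V d y) - 2)"
  proof -
    have "(\<Sum>y\<in>disc V d x j. int (deg V d y) - 2) =
      (\<Sum>y\<in>disc V d x j - leaves V d. int (deg V d y) - 2) +
      (\<Sum>y\<in>disc V d x j \<inter> leaves V d. int (deg V d y) - 2)"
      by (subst sum.Int_Diff[of "disc V d x j" _ "leaves V d"]) simp_all
    moreover have "(\<Sum>y\<in>disc V d x j \<inter> leaves V d. int (deg V d y) - 2) \<le> 0"
      by (rule sum_nonpos) (auto simp: leaves_def)
    ultimately show ?thesis by simp
  qed
  also have "\<dots> \<le> (\<Sum>y\<in>V - leaves V d. int (deg V d y) - 2)"
    by (rule sum_mono2) (auto simp: finite_V disc_def leaves_def)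
  finally show ?thesis
    using card_disc_step[OF assms(1), of j] sum_excess[OF assms(2)] by simp
qed

lemma disc_0: "x \<in> V \<Longrightarrow> disc V d x 0 = {x}"
  by (auto simp: disc_def dist_eq_0_iff)

lemma card_disc_le:
  assumes "x \<in> V" "2 \<le> card V"
  shows "card (disc V d x j) \<le> 1 + card (leaves V d) * j"
proof (induction j)
  case (Suc j)
  then show ?case using card_disc_step_le[OF assms, of j] by simp
qed (simp add: disc_0 assms)

lemma ex_at_dist:
  assumes "x \<in> V" "y \<in> V" "i \<le> d x y"
  shows "\<exists>z\<in>V. d x z = i"
  using assms(2,3)
proof (induction "d x y" arbitrary: y)
  case (Suc e)
  show ?case
  proof (cases "i = d x y")
    case False
    have "x \<noteq> y" using Suc.hyps(2) dist_self[OF assms(1)] by auto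
    then obtain p where "p \<in> V" "d x y = Suc (d x p)"
      using parentE[of x y] assms(1) Suc.prems by metis
    with Suc False show ?thesis by (metis le_Suc_eq nat.inject)
  qed (use Suc in auto)
qed auto

text \<open>A ball that is not yet everything gains a vertex with each step, since on the way to a
  vertex farther out every distance occurs.\<close>

lemma card_disc_ge:
  assumes "x \<in> V"
  shows "min (card V) (Suc j) \<le> card (disc V d x j)"
proof (induction j)
  case 0
  then show ?case by (simp add: disc_0 assms)
next
  case (Suc j)
  show ?case
  proof (cases "\<exists>y\<in>V. Suc j \<le> d x y")
    case True
    then obtain z where z: "z \<in> V" "d x z = Suc j" using ex_at_dist[OF assms] by blast
    then have "disc V d x j \<subseteq> disc V d x (Suc j)" "z \<in> disc V d x (Suc j) - disc V d x j"
      by (auto simp: disc_def)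
    then have "disc V d x j \<subset> disc V d x (Suc j)" by blast
    then have "card (disc V d x j) < card (disc V d x (Suc j))" by (simp add: psubset_card_mono)
    with Suc show ?thesis by simp
  next
    case False
    then have "disc V d x (Suc j) = V" by (fastforce simp: disc_def)
    then show ?thesis by simp
  qed
qed

section \<open>Counting pairs at small and at large distance\<close>

lemma near_eq_sum: "near V d j = (\<Sum>x\<in>V. card (disc V d x j))"
proof -
  have "{(x, y) \<in> V \<times> V. d x y \<le> j} = (SIGMA x:V. disc V d x j)"
    by (auto simp: disc_def)
  then show ?thesis by (simp add: near_def card_SigmaI finite_V)
qed

lemma near_0: "near V d 0 = card V"
  by (simp add: near_eq_sum disc_0)

lemma sum_disc_swap:
  fixes f :: "'a \<Rightarrow> int"
  shows "(\<Sum>x\<in>V. \<Sum>y\<in>disc V d x j. f y) = (\<Sum>y\<in>V. f y * int (card (disc V d y j)))"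
proof -
  have "(\<Sum>x\<in>V. \<Sum>y\<in>disc V d x j. f y) = (\<Sum>y\<in>V. \<Sum>x\<in>{x\<in>V. d x y \<le> j}. f y)"
    unfolding disc_def by (rule sum.swap_restrict) (auto simp: finite_V)
  also have "\<dots> = (\<Sum>y\<in>V. \<Sum>x\<in>disc V d y j. f y)"
    by (intro sum.cong refl) (auto simp: disc_def dist_commute)
  finally show ?thesis by (simp add: mult.commute)
qed

lemma near_Suc:
  "int (near V d (Suc j)) = int (near V d j) + 2 * int (card V) +
    (\<Sum>y\<in>V. (int (deg V d y) - 2) * int (card (disc V d y j)))"
proof -
  have "int (near V d (Suc j)) = (\<Sum>x\<in>V. int (card (disc V d x j)) + 2 +
      (\<Sum>y\<in>disc V d x j. int (deg V d y) - 2))"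
    by (simp add: near_eq_sum card_disc_step)
  then show ?thesis by (simp add: sum.distrib near_eq_sum sum_disc_swap)
qed

lemma near_plus_far: "near V d j + far V d j = card V * card V"
proof -
  let ?A = "{(x, y) \<in> V \<times> V. d x y \<le> j}" and ?B = "{(x, y) \<in> V \<times> V. j < d x y}"
  have un: "?A \<union> ?B = V \<times> V" by auto
  have "finite (V \<times> V)" by (simp add: finite_V)
  then have "finite ?A" "finite ?B" by (auto elim: finite_subset[rotated])
  moreover have "?A \<inter> ?B = {}" by auto
  ultimately have "card (?A \<union> ?B) = card ?A + card ?B" by (rule card_Un_disjoint)
  then show ?thesis unfolding un near_def far_def by (simp add: card_cartesian_product)
qed

text \<open>What remains when \<open>card_disc_Suc\<close> is subtracted from
  \<open>sum_deg\<close>: beyond radius \<open>j\<close> every vertex has \<open>deg - 1\<close>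
  children.\<close>

lemma card_beyond_Suc:
  assumes "x \<in> V"
  shows "int (card {y \<in> V. Suc j < d x y}) = (\<Sum>y\<in>{y \<in> V. j < d x y}. int (deg V d y) - 1)"
proof -
  have sub: "disc V d x j \<subseteq> V" for j by (auto simp: disc_def)
  have ne: "V \<noteq> {}" using assms by blast
  have eq: "{y \<in> V. j < d x y} = V - disc V d x j" for j by (auto simp: disc_def)
  have "(\<Sum>y\<in>V - disc V d x j. int (deg V d y) - 1) =
      int (card V) - 2 - (\<Sum>y\<in>disc V d x j. int (deg V d y) - 1)"
    using sum.subset_diff[OF sub finite_V, of "\<lambda>y. int (deg V d y) - 1" j] sum_deg[OF ne] by simp
  moreover have "int (card (V - disc V d x (Suc j))) = int (card V) - int (card (disc V d x (Suc j)))"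
    using sub by (simp add: card_Diff_subset card_mono finite_V of_nat_diff)
  ultimately show ?thesis using card_disc_Suc[OF assms, of j] by (simp add: eq)
qed

text \<open>\<open>card_beyond_Suc\<close> is applied to one end of the pair and, after an exchange
  of the sums, to the other. Each end thus moves one step inwards and contributes a factor
  \<open>deg - 1\<close>.\<close>

lemma far_Suc_Suc:
  "int (far V d (Suc (Suc j))) =
    (\<Sum>x\<in>V. \<Sum>y\<in>{y \<in> V. j < d x y}. (int (deg V d x) - 1) * (int (deg V d y) - 1))"
proof -
  have "{(x, y) \<in> V \<times> V. Suc (Suc j) < d x y} = (SIGMA x:V. {y \<in> V. Suc (Suc j) < d x y})" by auto
  then have "int (far V d (Suc (Suc j))) = (\<Sum>x\<in>V. int (card {y \<in> V. Suc (Suc j) < d x y}))"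
    by (simp add: far_def card_SigmaI finite_V)
  also have "\<dots> = (\<Sum>x\<in>V. \<Sum>y\<in>{y \<in> V. Suc j < d x y}. int (deg V d y) - 1)"
    by (rule sum.cong) (simp_all add: card_beyond_Suc)
  also have "\<dots> = (\<Sum>y\<in>V. \<Sum>x\<in>{x \<in> V. Suc j < d x y}. int (deg V d y) - 1)"
    by (rule sum.swap_restrict) (auto simp: finite_V)
  also have "\<dots> = (\<Sum>y\<in>V. (int (deg V d y) - 1) * int (card {x \<in> V. Suc j < d y x}))"
    by (auto intro!: sum.cong arg_cong[of _ _ card] simp: dist_commute)
  also have "\<dots> = (\<Sum>y\<in>V. (int (deg V d y) - 1) * (\<Sum>x\<in>{x \<in> V. j < d y x}. int (deg V d x) - 1))"
    by (rule sum.cong) (simp_all add: card_beyond_Suc)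
  finally show ?thesis by (simp add: sum_distrib_left)
qed

end

section \<open>Pruning leaves\<close>

context tree_metric
begin

text \<open>Besides \<open>y\<close>, the vertex \<open>p\<close> has its own parent towards
  \<open>x\<close> as a neighbour.\<close>

lemma deg_ge_2_between:
  assumes "x \<in> V" "y \<in> V" "p \<in> V" "d y p = 1" "d x y = Suc (d x p)" "x \<noteq> p"
  shows "2 \<le> deg V d p"
proof -
  obtain r where r: "r \<in> V" "d p r = 1" "d x p = Suc (d x r)"
    using parentE[of x p] assms by metis
  then have "y \<noteq> r" using assms by auto
  moreover have "{y, r} \<subseteq> nbrs V d p"
    using r assms by (auto simp: nbrs_def dist_commute)
  then have "card {y, r} \<le> deg V d p"
    unfolding deg_def by (rule card_mono[rotated]) simp
  ultimately show ?thesis by simp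
qed

text \<open>A parent seen from a surviving \<open>x\<close> is either \<open>x\<close> itself or
  strictly between two vertices, hence of degree at least 2; so it is never among the deleted
  leaves.\<close>

lemma remove_leaves:
  assumes "W \<subseteq> leaves V d"
  shows "tree_metric (V - W) d"
proof
  show "finite (V - W)" using finite_V by simp
next
  fix x y assume "x \<in> V - W" "y \<in> V - W" "x \<noteq> y"
  then have xy: "x \<in> V" "y \<in> V" "x \<notin> W" "x \<noteq> y" by auto
  obtain p where p: "p \<in> V" "d y p = 1" "d x y = Suc (d x p)"
    "\<And>z. z \<in> V \<Longrightarrow> d y z = 1 \<Longrightarrow> z \<noteq> p \<Longrightarrow> d x z = Suc (d x y)"
    using parentE[OF xy(1,2,4)] by blast
  have "p \<notin> W"
  proof
    assume "p \<in> W"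
    then have "deg V d p \<le> 1" "x \<noteq> p" using assms xy by (auto simp: leaves_def)
    with deg_ge_2_between[OF xy(1,2) p(1-3)] show False by simp
  qed
  with p show "\<exists>p\<in>V - W. d y p = 1 \<and> d x y = Suc (d x p) \<and>
      (\<forall>z\<in>V - W. d y z = 1 \<and> z \<noteq> p \<longrightarrow> d x z = Suc (d x y))"
    by (intro bexI[of _ p]) auto
qed (auto simp: dist_eq_0_iff dist_commute)

text \<open>Only the neighbour of \<open>u\<close> can become a new leaf, and it then takes the
  place of \<open>u\<close>.\<close>

lemma card_leaves_remove_leaf:
  assumes "u \<in> leaves V d"
  shows "card (leaves (V - {u}) d) \<le> card (leaves V d)"
proof -
  have u: "u \<in> V" "card (nbrs V d u) \<le> 1" using assms by (auto simp: leaves_def deg_def)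
  have "nbrs (V - {u}) d x = nbrs V d x" if "x \<in> V" "x \<notin> nbrs V d u" for x
    using that u by (auto simp: nbrs_def dist_commute)
  then have "leaves (V - {u}) d \<subseteq> (leaves V d - {u}) \<union> nbrs V d u"
    by (auto simp: leaves_def deg_def)
  then have "card (leaves (V - {u}) d) \<le> card ((leaves V d - {u}) \<union> nbrs V d u)"
    by (rule card_mono[rotated]) (simp add: leaves_def finite_V)
  also have "\<dots> \<le> card (leaves V d - {u}) + card (nbrs V d u)" by (rule card_Un_le)
  also have "\<dots> \<le> card (leaves V d - {u}) + 1" using u by simp
  also have "\<dots> = card (leaves V d)"
    using assms finite_V by (subst card.remove[OF _ assms]) (simp_all add: leaves_def)
  finally show ?thesis .
qed

lemma leaves_nonempty: "V \<noteq> {} \<Longrightarrow> leaves V d \<noteq> {}"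
proof
  assume ne: "V \<noteq> {}" and "leaves V d = {}"
  then have "0 \<le> (\<Sum>y\<in>V. int (deg V d y) - 2)"
    by (intro sum_nonneg) (force simp: leaves_def)
  then have "int (card V) \<le> (\<Sum>y\<in>V. int (deg V d y) - 1)"
    by (simp add: sum_subtractf)
  with sum_deg[OF ne] show False by simp
qed

end

lemma leaves_remove_mono:
  assumes "finite V"
  shows "leaves V d - {u} \<subseteq> leaves (V - {u}) d"
proof -
  have "deg (V - {u}) d x \<le> deg V d x" for x
    unfolding deg_def by (rule card_mono) (use assms in \<open>auto simp: nbrs_def\<close>)
  then show ?thesis by (force simp: leaves_def intro: order_trans)
qed

text \<open>Leaves are deleted one by one, those of \<open>W\<close> first; the rest of
  \<open>W\<close> stay leaves meanwhile, and no deletion increases the number of leaves.\<close>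

lemma exists_subtree:
  assumes "tree_metric V d" "W \<subseteq> leaves V d" "card W + s \<le> card V"
  shows "\<exists>B. B \<subseteq> V - W \<and> card B = s \<and> tree_metric B d \<and> card (leaves B d) \<le> card (leaves V d)"
  using assms
proof (induction "card V - s" arbitrary: V W)
  case 0
  interpret tree_metric V d by fact
  have "card W = 0" using 0 by simp
  moreover have "finite W" by (rule finite_subset[OF _ finite_V]) (use 0 in \<open>auto simp: leaves_def\<close>)
  ultimately have "W = {}" by simp
  with 0 show ?case by (intro exI[of _ V]) auto
next
  case (Suc c)
  interpret tree_metric V d by fact
  have finW: "finite W" by (rule finite_subset[OF _ finite_V]) (use Suc.prems in \<open>auto simp: leaves_def\<close>)
  have "V \<noteq> {}" using Suc.hyps(2) by auto
  then obtain u where u: "u \<in> leaves V d" "W \<noteq> {} \<Longrightarrow> u \<in> W"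
    using leaves_nonempty Suc.prems by blast
  have uV: "u \<in> V" using u by (simp add: leaves_def)
  have tm: "tree_metric (V - {u}) d" by (rule remove_leaves) (use u in simp)
  have cV: "card (V - {u}) = card V - 1" using uV finite_V by simp
  have 1: "c = card (V - {u}) - s" using Suc.hyps(2) cV by simp
  have 2: "W - {u} \<subseteq> leaves (V - {u}) d"
    using leaves_remove_mono[OF finite_V, of d u] Suc.prems by blast
  have 3: "card (W - {u}) + s \<le> card (V - {u})"
  proof (cases "W = {}")
    case False
    have "card W = Suc (card (W - {u}))" by (rule card.remove[OF finW u(2)[OF False]])
    with Suc.prems cV show ?thesis by simp
  qed (use Suc.hyps(2) cV in simp)
  obtain B where "B \<subseteq> V - {u} - (W - {u})" "card B = s" "tree_metric B d"
    "card (leaves B d) \<le> card (leaves (V - {u}) d)"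
    using Suc.hyps(1)[OF 1 tm 2 3] by blast
  with card_leaves_remove_leaf[OF u(1)] show ?case by (intro exI[of _ B]) auto
qed

section \<open>Far pairs of a tree and of its pruned subtrees\<close>

context tree_metric
begin

lemma sum_pairs_le_far_Suc_Suc:
  assumes "B \<subseteq> V"
  shows "(\<Sum>x\<in>B. \<Sum>y\<in>{y \<in> B. j < d x y}. (int (deg V d x) - 1) * (int (deg V d y) - 1))
    \<le> int (far V d (Suc (Suc j)))" (is "(\<Sum>x\<in>B. \<Sum>y\<in>_. ?w x y) \<le> _")
proof -
  have pos: "0 \<le> ?w x y" if "x \<in> V" "y \<in> {y \<in> V. j < d x y}" for x y
  proof (cases "2 \<le> card V")
    case True
    then show ?thesis using deg_pos[of x] deg_pos[of y] that by simp
  next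
    \<comment> \<open>\<open>deg_pos\<close> does not apply to a single vertex, but then no pair has
      positive distance.\<close>
    case False
    then have "card V = 1" using that finite_V by (cases "card V") auto
    then have "x = y" using that by (auto simp: card_1_singleton_iff)
    then show ?thesis using that dist_self by simp
  qed
  have "(\<Sum>x\<in>B. \<Sum>y\<in>{y \<in> B. j < d x y}. ?w x y) \<le> (\<Sum>x\<in>B. \<Sum>y\<in>{y \<in> V. j < d x y}. ?w x y)"
    by (intro sum_mono sum_mono2) (use assms pos finite_V in auto)
  also have "\<dots> \<le> (\<Sum>x\<in>V. \<Sum>y\<in>{y \<in> V. j < d x y}. ?w x y)"
    by (intro sum_mono2 sum_nonneg pos) (use assms finite_V in auto)
  also have "\<dots> = int (far V d (Suc (Suc j)))" by (rule far_Suc_Suc[symmetric])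
  finally show ?thesis .
qed

lemma far_eq_sum:
  assumes "finite B"
  shows "int (far B d j) = (\<Sum>x\<in>B. \<Sum>y\<in>{y \<in> B. j < d x y}. 1)"
proof -
  have "{(x, y) \<in> B \<times> B. j < d x y} = (SIGMA x:B. {y \<in> B. j < d x y})" by auto
  then show ?thesis by (simp add: far_def card_SigmaI assms)
qed

lemma nonleaf_pair_weight:
  assumes "x \<in> V - leaves V d" "y \<in> V - leaves V d"
  shows "int (deg V d x) - 1 \<le> (int (deg V d x) - 1) * (int (deg V d y) - 1)"
    and "1 \<le> (int (deg V d x) - 1) * (int (deg V d y) - 1)"
proof -
  have 1: "1 \<le> int (deg V d x) - 1" "1 \<le> int (deg V d y) - 1"
    using assms by (auto simp: leaves_def)
  then show "int (deg V d x) - 1 \<le> (int (deg V d x) - 1) * (int (deg V d y) - 1)"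
    using mult_left_mono[of 1 "int (deg V d y) - 1" "int (deg V d x) - 1"] by simp
  with 1 show "1 \<le> (int (deg V d x) - 1) * (int (deg V d y) - 1)" by linarith
qed

text \<open>Among the pairs that \<open>far_Suc_Suc\<close> sums over, those of nonleaves weigh at
  least 1 and none weighs less than 0.\<close>

lemma far_le_far_Suc_Suc:
  assumes "B \<subseteq> V - leaves V d"
  shows "far B d j \<le> far V d (Suc (Suc j))"
proof -
  have finB: "finite B" by (rule finite_subset[OF _ finite_V]) (use assms in auto)
  have "int (far B d j) \<le>
      (\<Sum>x\<in>B. \<Sum>y\<in>{y \<in> B. j < d x y}. (int (deg V d x) - 1) * (int (deg V d y) - 1))"
    unfolding far_eq_sum[OF finB] by (intro sum_mono nonleaf_pair_weight(2)) (use assms in auto)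
  also have "\<dots> \<le> int (far V d (Suc (Suc j)))"
    by (rule sum_pairs_le_far_Suc_Suc) (use assms in auto)
  finally show ?thesis by simp
qed

text \<open>The pair of \<open>c\<close> and \<open>y0\<close> weighs at least 2. In the case of
  equality this excludes nonleaves far from a branch vertex.\<close>

lemma far_less_far_Suc_Suc:
  assumes "c \<in> V" "3 \<le> deg V d c" "y0 \<in> V - leaves V d" "j < d c y0"
  shows "far (V - leaves V d) d j < far V d (Suc (Suc j))"
proof -
  let ?B = "V - leaves V d"
  let ?w = "\<lambda>x y. (int (deg V d x) - 1) * (int (deg V d y) - 1)"
  have cB: "c \<in> ?B" using assms by (auto simp: leaves_def)
  have "int (far ?B d j) = (\<Sum>x\<in>?B. \<Sum>y\<in>{y \<in> ?B. j < d x y}. 1)"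
    by (rule far_eq_sum) (simp add: finite_V)
  also have "\<dots> < (\<Sum>x\<in>?B. \<Sum>y\<in>{y \<in> ?B. j < d x y}. ?w x y)"
  proof (rule sum_strict_mono_ex1)
    show "\<forall>x\<in>?B. (\<Sum>y\<in>{y \<in> ?B. j < d x y}. 1) \<le> (\<Sum>y\<in>{y \<in> ?B. j < d x y}. ?w x y)"
      by (intro ballI sum_mono nonleaf_pair_weight(2)) auto
    have "(\<Sum>y\<in>{y \<in> ?B. j < d c y}. 1) < (\<Sum>y\<in>{y \<in> ?B. j < d c y}. ?w c y)"
    proof (rule sum_strict_mono_ex1)
      show "\<forall>y\<in>{y \<in> ?B. j < d c y}. 1 \<le> ?w c y"
        using cB by (intro ballI nonleaf_pair_weight(2)) auto
      have "1 < ?w c y0"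
        using nonleaf_pair_weight(1)[OF cB assms(3)] assms(2) by linarith
      then show "\<exists>y\<in>{y \<in> ?B. j < d c y}. 1 < ?w c y" using assms by auto
    qed (simp add: finite_V)
    then show "\<exists>x\<in>?B. (\<Sum>y\<in>{y \<in> ?B. j < d x y}. 1) < (\<Sum>y\<in>{y \<in> ?B. j < d x y}. ?w x y)"
      using cB by blast
  qed (simp add: finite_V)
  also have "\<dots> \<le> int (far V d (Suc (Suc j)))"
    by (rule sum_pairs_le_far_Suc_Suc) auto
  finally show ?thesis by simp
qed

end

section \<open>Starlike trees\<close>

text \<open>The sum of the two truncated differences is the absolute difference along a branch;
  paths between different branches pass through the centre. The vertex \<open>Some (i, j)\<close>
  has depth \<open>j + 1\<close>.\<close>

fun sdist :: "(nat \<times> nat) option \<Rightarrow> (nat \<times> nat) option \<Rightarrow> nat" where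
  "sdist None None = 0"
| "sdist None (Some (i, j)) = Suc j"
| "sdist (Some (i, j)) None = Suc j"
| "sdist (Some (i, j)) (Some (i', j')) = (if i = i' then (j - j') + (j' - j) else Suc (Suc (j + j')))"

definition sverts :: "nat \<Rightarrow> (nat \<Rightarrow> nat) \<Rightarrow> (nat \<times> nat) option set" where
  "sverts k l = insert None (Some ` {(i, j). i < k \<and> j < l i})"

lemma sverts_eq_Sigma: "sverts k l = insert None (Some ` (SIGMA i:{..<k}. {..<l i}))"
  by (auto simp: sverts_def)

lemma finite_sverts [simp]: "finite (sverts k l)"
  by (simp add: sverts_eq_Sigma)

lemma card_sverts: "card (sverts k l) = Suc (\<Sum>i<k. l i)"
proof -
  have "card (sverts k l) = Suc (card (Some ` (SIGMA i:{..<k}. {..<l i})))"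
    unfolding sverts_eq_Sigma by (rule card_insert_disjoint) auto
  also have "card (Some ` (SIGMA i:{..<k}. {..<l i})) = (\<Sum>i<k. l i)"
    by (subst card_image) (auto simp: card_SigmaI)
  finally show ?thesis .
qed

lemma sverts_iff [simp]:
  "None \<in> sverts k l" "Some (i, j) \<in> sverts k l \<longleftrightarrow> i < k \<and> j < l i"
  by (auto simp: sverts_def)

lemma sdist_eq_1_iff:
  "sdist (Some (i, j)) y = 1 \<longleftrightarrow>
    y = (if j = 0 then None else Some (i, j - 1)) \<or> y = Some (i, Suc j)"
  by (cases y) (auto split: if_splits)

lemma sdist_None_eq_1_iff: "sdist None y = 1 \<longleftrightarrow> (\<exists>i. y = Some (i, 0))"
  by (cases y) auto

lemma sdist_commute: "sdist x y = sdist y x"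
  by (cases x; cases y) auto

text \<open>The parent of \<open>y\<close> seen from \<open>x\<close> is the first vertex of the
  branch of \<open>x\<close> if \<open>y\<close> is the centre, the next vertex outwards if
  \<open>x\<close> lies farther out on the branch of \<open>y\<close>, and the next vertex inwards
  otherwise.\<close>

lemma tree_metric_starlike: "tree_metric (sverts k l) sdist"
proof
  fix x y assume "x \<in> sverts k l" "y \<in> sverts k l"
  then show "sdist x y = 0 \<longleftrightarrow> x = y" by (cases x; cases y) (auto split: if_splits)
next
  fix x y :: "(nat \<times> nat) option"
  assume V: "x \<in> sverts k l" "y \<in> sverts k l" and "x \<noteq> y"
  show "\<exists>p\<in>sverts k l. sdist y p = 1 \<and> sdist x y = Suc (sdist x p) \<and>
      (\<forall>z\<in>sverts k l. sdist y z = 1 \<and> z \<noteq> p \<longrightarrow> sdist x z = Suc (sdist x y))"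
  proof (cases y)
    case None
    then obtain i j where x: "x = Some (i, j)" using \<open>x \<noteq> y\<close> by (cases x) auto
    show ?thesis
      by (rule bexI[of _ "Some (i, 0)"])
        (use V None x in \<open>auto simp: sdist_None_eq_1_iff simp del: One_nat_def split: if_splits\<close>)
  next
    case (Some ab)
    then obtain a b where y: "y = Some (a, b)" by (cases ab) auto
    show ?thesis
    proof (cases "\<exists>j>b. x = Some (a, j)")
      case True
      then obtain j where j: "b < j" "x = Some (a, j)" by blast
      show ?thesis
        by (rule bexI[of _ "Some (a, Suc b)"])
          (use V y j in \<open>auto simp: sdist_eq_1_iff simp del: One_nat_def split: if_splits\<close>)
    next
      case False
      then have le: "j \<le> b" if "x = Some (a, j)" for j using that by (metis not_le)
      show ?thesis
      proof (rule bexI[of _ "if b = 0 then None else Some (a, b - 1)"], intro conjI ballI impI)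
        show "sdist y (if b = 0 then None else Some (a, b - 1)) = 1"
          by (simp add: y)
        show "sdist x y = Suc (sdist x (if b = 0 then None else Some (a, b - 1)))"
          using le \<open>x \<noteq> y\<close> by (cases x) (fastforce simp: y)+
        fix z assume "sdist y z = 1 \<and> z \<noteq> (if b = 0 then None else Some (a, b - 1))"
        then have "z = Some (a, Suc b)" unfolding y sdist_eq_1_iff by blast
        then show "sdist x z = Suc (sdist x y)"
          using le by (cases x) (fastforce simp: y)+
      qed (use V y in auto)
    qed
  qed
qed (simp_all add: sdist_commute)

lemma nbrs_starlike_None:
  assumes "\<And>i. i < k \<Longrightarrow> 0 < l i"
  shows "nbrs (sverts k l) sdist None = (\<lambda>i. Some (i, 0)) ` {..<k}"
  using assms unfolding nbrs_def sdist_None_eq_1_iff by auto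

lemma deg_starlike_None:
  assumes "\<And>i. i < k \<Longrightarrow> 0 < l i"
  shows "deg (sverts k l) sdist None = k"
  unfolding deg_def
  by (subst nbrs_starlike_None) (use assms in \<open>auto intro!: card_image[THEN trans] inj_onI\<close>)

lemma deg_starlike_Some:
  assumes "i < k" "j < l i"
  shows "deg (sverts k l) sdist (Some (i, j)) = (if Suc j < l i then 2 else 1)"
proof -
  have "nbrs (sverts k l) sdist (Some (i, j)) =
      {if j = 0 then None else Some (i, j - 1)} \<union> (if Suc j < l i then {Some (i, Suc j)} else {})"
    using assms unfolding nbrs_def sdist_eq_1_iff by auto
  then show ?thesis by (auto simp: deg_def)
qed

text \<open>Nonempty branches make \<open>k\<close> the degree of the centre, and
  \<open>2 \<le> k\<close> keeps the centre from being a leaf.\<close>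

locale starlike_tree =
  fixes k :: nat and l :: "nat \<Rightarrow> nat"
  assumes two_le_k: "2 \<le> k" and l_pos: "\<And>i. i < k \<Longrightarrow> 0 < l i"
begin

abbreviation "S \<equiv> sverts k l"

sublocale tree_metric S sdist
  by (rule tree_metric_starlike)

lemma deg_None: "deg S sdist None = k"
  by (rule deg_starlike_None) (rule l_pos)

lemma leaves_eq: "leaves S sdist = (\<lambda>i. Some (i, l i - 1)) ` {..<k}"
proof (intro equalityI subsetI)
  fix x assume "x \<in> leaves S sdist"
  then have x: "x \<in> S" "deg S sdist x \<le> 1" by (auto simp: leaves_def)
  then obtain i j where ij: "x = Some (i, j)"
    using deg_None two_le_k by (cases x) auto
  with x have "i < k" "j < l i" "\<not> Suc j < l i" by (auto simp: deg_starlike_Some split: if_splits)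
  then show "x \<in> (\<lambda>i. Some (i, l i - 1)) ` {..<k}" by (force simp: ij)
next
  fix x assume "x \<in> (\<lambda>i. Some (i, l i - 1)) ` {..<k}"
  then obtain i where "i < k" "x = Some (i, l i - 1)" by blast
  then show "x \<in> leaves S sdist" using l_pos[of i] by (simp add: leaves_def deg_starlike_Some)
qed

lemma card_S: "2 \<le> card S"
proof -
  have "l 0 \<le> (\<Sum>i<k. l i)" by (rule member_le_sum) (use two_le_k in auto)
  then show ?thesis using l_pos[of 0] two_le_k by (simp add: card_sverts)
qed

lemma nonleaf_deg: "x \<in> S - leaves S sdist \<Longrightarrow> x \<noteq> None \<Longrightarrow> deg S sdist x = 2"
proof -
  assume x: "x \<in> S - leaves S sdist" "x \<noteq> None"
  then obtain i j where "x = Some (i, j)" by (cases x) auto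
  with x show ?thesis by (auto simp: deg_starlike_Some leaves_def split: if_splits)
qed

lemma sum_deg_minus_2:
  fixes f :: "(nat \<times> nat) option \<Rightarrow> int"
  shows "(\<Sum>y\<in>S. (int (deg S sdist y) - 2) * f y) = (int k - 2) * f None - (\<Sum>i<k. f (Some (i, l i - 1)))"
proof -
  have N: "None \<in> S - leaves S sdist" by (auto simp: leaves_eq)
  have "(\<Sum>y\<in>S - leaves S sdist. (int (deg S sdist y) - 2) * f y) = (int k - 2) * f None"
    using nonleaf_deg by (subst sum.remove[OF _ N]) (auto simp: deg_None)
  moreover have "(\<Sum>y\<in>leaves S sdist. f y) = (\<Sum>i<k. f (Some (i, l i - 1)))"
    unfolding leaves_eq by (subst sum.reindex) (auto intro: inj_onI)
  ultimately show ?thesis using sum_split_leaves[OF card_S, of f] by simp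
qed

lemma leaves_removed: "S - leaves S sdist = sverts k (\<lambda>i. l i - 1)"
proof (intro equalityI subsetI)
  fix x assume "x \<in> S - leaves S sdist"
  then show "x \<in> sverts k (\<lambda>i. l i - 1)"
    by (cases x) (auto simp: leaves_def deg_starlike_Some split: if_splits)
next
  fix x assume "x \<in> sverts k (\<lambda>i. l i - 1)"
  then show "x \<in> S - leaves S sdist"
    using two_le_k by (cases x) (auto simp: leaves_def deg_starlike_Some deg_None split: if_splits)
qed

end

locale balanced_starlike = starlike_tree +
  fixes m :: nat
  assumes l_le: "\<And>i. i < k \<Longrightarrow> l i \<le> m" and m_le: "\<And>i. i < k \<Longrightarrow> m \<le> Suc (l i)"
begin

text \<open>As each branch has at least \<open>m - 1\<close> vertices, the balls enlarged here
  contain no leaf. The centre alone contributes its excess \<open>k - 2\<close>, and each step adds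
  \<open>k\<close> vertices.\<close>

lemma card_disc_None: "Suc j \<le> m \<Longrightarrow> card (disc S sdist None j) = 1 + k * j"
proof (induction j)
  case 0
  then show ?case using disc_0[of None] by simp
next
  case (Suc j)
  have "(\<Sum>y\<in>disc S sdist None j. int (deg S sdist y) - 2) = int k - 2"
  proof -
    have N: "None \<in> disc S sdist None j" by (simp add: disc_def)
    have "deg S sdist y = 2" if yd: "y \<in> disc S sdist None j - {None}" for y
    proof -
      obtain i b where y: "y = Some (i, b)" using yd by (cases y) auto
      then have "i < k" "b < l i" "Suc b \<le> j" using that by (auto simp: disc_def)
      moreover have "Suc b < l i" using calculation Suc.prems m_le[of i] by simp
      ultimately show ?thesis by (simp add: y deg_starlike_Some)
    qed
    then show ?thesis by (subst sum.remove[OF _ N]) (auto simp: deg_None)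
  qed
  then have "int (card (disc S sdist None (Suc j))) = int (1 + k * Suc j)"
    using card_disc_step[of None j] Suc by (simp add: algebra_simps)
  then show ?case by (simp only: of_nat_eq_iff)
qed

text \<open>The balls enlarged here stay inside one branch and miss the centre; their only vertex of
  degree other than 2 is the end itself, with excess -1.\<close>

lemma card_disc_end: "i < k \<Longrightarrow> Suc j \<le> m \<Longrightarrow> card (disc S sdist (Some (i, l i - 1)) j) = Suc j"
proof (induction j)
  case 0
  then show ?case using disc_0[of "Some (i, l i - 1)"] l_pos[of i] by simp
next
  case (Suc j)
  let ?e = "Some (i, l i - 1)"
  have e: "?e \<in> S" using Suc.prems l_pos[of i] by simp
  have jl: "j < l i" using Suc.prems m_le[of i] by simp
  have "(\<Sum>y\<in>disc S sdist ?e j. int (deg S sdist y) - 2) = -1"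
  proof -
    have N: "?e \<in> disc S sdist ?e j" using e by (simp add: disc_def)
    have "deg S sdist y = 2" if yd: "y \<in> disc S sdist ?e j - {?e}" for y
    proof -
      obtain a b where y: "y = Some (a, b)" using yd jl by (cases y) (auto simp: disc_def)
      then have "a = i" "b < l i" using that jl by (auto simp: disc_def split: if_splits)
      then show ?thesis using that y Suc.prems by (auto simp: deg_starlike_Some)
    qed
    then have "(\<Sum>y\<in>disc S sdist ?e j - {?e}. int (deg S sdist y) - 2) = 0" by simp
    moreover have "deg S sdist ?e = 1" using e by (subst deg_starlike_Some) auto
    ultimately show ?thesis by (subst sum.remove[OF _ N]) auto
  qed
  then show ?case using card_disc_step[OF e, of j] Suc by simp
qed

text \<open>Both estimates behind \<open>near_Suc_le\<close> are attained here, so the increment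
  equals the bound given there.\<close>

lemma near_Suc_eq:
  assumes "Suc j \<le> m"
  shows "int (near S sdist (Suc j)) = int (near S sdist j) + 2 * int (card S) +
    (int k - 2) * (1 + int k * int j) - int k * (int j + 1)"
  using near_Suc[of j] assms
  by (simp add: sum_deg_minus_2 card_disc_None card_disc_end del: One_nat_def)

text \<open>The formula of \<open>near_Suc_eq\<close> for \<open>j = 1\<close>, but covering
  \<open>m = 1\<close> as well: a ball of radius 1 always has \<open>1 + deg\<close>
  elements.\<close>

lemma near_2: "int (near S sdist 2) =
    int (near S sdist 1) + 2 * int (card S) + (int k - 2) * (1 + int k) - 2 * int k"
proof -
  have "card (disc S sdist x 1) = 1 + deg S sdist x" if "x \<in> S" for x
    using card_disc_step[OF that, of 0] disc_0[OF that] by simp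
  moreover have "deg S sdist (Some (i, l i - 1)) = 1" if "i < k" for i
    using that l_pos[OF that] by (subst deg_starlike_Some) auto
  ultimately show ?thesis
    using near_Suc[of 1] l_pos by (simp add: sum_deg_minus_2 deg_None numeral_2_eq_2)
qed

text \<open>Nonleaves have depth at most \<open>m - 1 \<le> j\<close>, so if two of them are at
  distance more than \<open>j\<close>, neither is the centre and both have degree 2. In
  \<open>far_Suc_Suc\<close> such pairs weigh 1, and pairs with a leaf weigh 0.\<close>

lemma far_Suc_Suc_eq:
  assumes "m \<le> Suc j"
  shows "far S sdist (Suc (Suc j)) = far (sverts k (\<lambda>i. l i - 1)) sdist j"
proof -
  let ?B = "sverts k (\<lambda>i. l i - 1)"
  let ?w = "\<lambda>x y. (int (deg S sdist x) - 1) * (int (deg S sdist y) - 1)"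
  have B: "?B = S - leaves S sdist" by (rule leaves_removed[symmetric])
  have sub: "?B \<subseteq> S" unfolding B by blast
  have leaf: "deg S sdist x = 1" if "x \<in> S" "x \<notin> ?B" for x
    using that deg_pos[OF _ card_S, of x] unfolding B by (auto simp: leaves_def)
  have w: "?w x y = 1" if xy: "x \<in> ?B" "y \<in> ?B" "j < sdist x y" for x y
  proof -
    have "z = None \<or> sdist None z \<le> j \<and> sdist z None \<le> j" if "z \<in> ?B" for z
      using that l_le assms by (cases z) (fastforce simp: sdist_commute)+
    then have "x \<noteq> None" "y \<noteq> None" using xy by (metis not_le sdist.simps(1) le0)+
    then have "deg S sdist x = 2" "deg S sdist y = 2" using xy nonleaf_deg unfolding B by blast+
    then show ?thesis by simp
  qed
  have "int (far S sdist (Suc (Suc j))) = (\<Sum>x\<in>S. \<Sum>y\<in>{y \<in> S. j < sdist x y}. ?w x y)"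
    by (rule far_Suc_Suc)
  also have "\<dots> = (\<Sum>x\<in>?B. \<Sum>y\<in>{y \<in> S. j < sdist x y}. ?w x y)"
    by (rule sum.mono_neutral_right) (use sub in \<open>auto simp: leaf simp del: One_nat_def\<close>)
  also have "\<dots> = (\<Sum>x\<in>?B. \<Sum>y\<in>{y \<in> ?B. j < sdist x y}. ?w x y)"
    by (rule sum.cong[OF refl], rule sum.mono_neutral_right)
      (use sub in \<open>auto simp del: One_nat_def, metis leaf\<close>)
  also have "\<dots> = (\<Sum>x\<in>?B. \<Sum>y\<in>{y \<in> ?B. j < sdist x y}. 1)"
    by (intro sum.cong refl w) auto
  also have "\<dots> = int (far ?B sdist j)"
  proof -
    have "{(x, y) \<in> ?B \<times> ?B. j < sdist x y} = (SIGMA x:?B. {y \<in> ?B. j < sdist x y})" by auto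
    then show ?thesis by (simp add: far_def card_SigmaI)
  qed
  finally show ?thesis by simp
qed

end

section \<open>The balanced starlike tree has the most close pairs\<close>

context tree_metric
begin

lemma near_1:
  assumes "V \<noteq> {}"
  shows "int (near V d 1) = 3 * int (card V) - 2"
proof -
  have "(\<Sum>y\<in>V. int (deg V d y) - 2) = - 2"
    using sum_deg[OF assms] by (simp add: sum_subtractf)
  then show ?thesis using near_Suc[of 0] by (simp add: near_0 disc_0)
qed

lemma card_disc_leaf_ge:
  assumes "Suc j \<le> card V"
  shows "int (card (leaves V d)) * (int j + 1) \<le> (\<Sum>y\<in>leaves V d. int (card (disc V d y j)))"
proof -
  have "int j + 1 \<le> int (card (disc V d y j))" if "y \<in> leaves V d" for y
    using card_disc_ge[of y j] that assms by (simp add: leaves_def)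
  then have "(\<Sum>y\<in>leaves V d. int j + 1) \<le> (\<Sum>y\<in>leaves V d. int (card (disc V d y j)))"
    by (rule sum_mono)
  then show ?thesis by simp
qed

text \<open>For \<open>L\<close> leaves, nonleaves have nonnegative excess and balls of at most
  \<open>1 + L * j\<close> vertices, while each leaf subtracts a ball of at least
  \<open>j + 1\<close> vertices.\<close>

lemma near_Suc_le:
  assumes "2 \<le> card V" "card (leaves V d) \<le> k" "Suc j \<le> card V"
  shows "int (near V d (Suc j)) \<le> int (near V d j) + 2 * int (card V) +
    (int k - 2) * (1 + int k * int j) - int k * (int j + 1)"
proof -
  let ?L = "int (card (leaves V d))"
  have L: "2 \<le> ?L" "?L \<le> int k" using two_le_card_leaves[OF assms(1)] assms by auto
  have "(\<Sum>y\<in>V - leaves V d. (int (deg V d y) - 2) * int (card (disc V d y j)))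
      \<le> (\<Sum>y\<in>V - leaves V d. (int (deg V d y) - 2) * (1 + ?L * int j))"
  proof (intro sum_mono mult_left_mono)
    fix y assume "y \<in> V - leaves V d"
    then show "int (card (disc V d y j)) \<le> 1 + ?L * int j" "0 \<le> int (deg V d y) - 2"
      using card_disc_le[of y j] assms(1) by (auto simp: leaves_def simp flip: of_nat_mult)
  qed
  also have "\<dots> = (?L - 2) * (1 + ?L * int j)"
    by (simp only: sum_distrib_right[symmetric] sum_excess[OF assms(1)])
  finally have "(\<Sum>y\<in>V. (int (deg V d y) - 2) * int (card (disc V d y j)))
      \<le> (?L - 2) * (1 + ?L * int j) - ?L * (int j + 1)"
    using card_disc_leaf_ge[OF assms(3)] sum_split_leaves[OF assms(1), of "\<lambda>y. int (card (disc V d y j))"]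
    by linarith
  also have "\<dots> \<le> (int k - 2) * (1 + int k * int j) - int k * (int j + 1)"
  proof -
    \<comment> \<open>The bound for \<open>L\<close> leaves is
      \<open>j * L^2 - 3 * j * L - 2\<close>. The difference of its values at \<open>k\<close> and
      \<open>L\<close> factors, and \<open>k + L - 3\<close> is positive because of
      \<open>2 \<le> L \<le> k\<close>.\<close>
    have "0 \<le> int j * ((int k - ?L) * (int k + ?L - 3))"
      using L by simp
    also have "\<dots> = ((int k - 2) * (1 + int k * int j) - int k * (int j + 1)) -
        ((?L - 2) * (1 + ?L * int j) - ?L * (int j + 1))"
      by (simp add: algebra_simps)
    finally show ?thesis by simp
  qed
  finally show ?thesis using near_Suc[of j] by simp
qed

end

text \<open>The ceiling of \<open>(n - 1) / k\<close>, which is the length of a longest branch of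
  \<open>BS n k\<close>.\<close>

definition height :: "nat \<Rightarrow> nat \<Rightarrow> nat" where
  "height n k = (n - 1) div k + (if (n - 1) mod k = 0 then 0 else 1)"

lemma branch_size_le_height: "branch_size n k i \<le> height n k"
  by (auto simp: branch_size_def height_def)

lemma height_le_Suc_branch_size: "height n k \<le> Suc (branch_size n k i)"
  by (auto simp: branch_size_def height_def)

lemma height_le:
  assumes "0 < k"
  shows "height n k \<le> n - 1"
proof -
  have "(n - 1) div k \<le> k * ((n - 1) div k)" using assms by simp
  moreover have "k * ((n - 1) div k) + (n - 1) mod k = n - 1" by simp
  ultimately show ?thesis unfolding height_def by (split if_split) linarith
qed

lemma div_mod_shift:
  fixes k n :: nat
  assumes "0 < k" "k + 1 \<le> n"
  shows "(n - 1) div k = Suc ((n - k - 1) div k)" "(n - 1) mod k = (n - k - 1) mod k"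
proof -
  obtain a where "n = k + 1 + a" using assms(2) le_Suc_ex by blast
  then show "(n - 1) div k = Suc ((n - k - 1) div k)" "(n - 1) mod k = (n - k - 1) mod k"
    using assms(1) by simp_all
qed

lemma height_shift: "0 < k \<Longrightarrow> k + 1 \<le> n \<Longrightarrow> height n k = Suc (height (n - k) k)"
  by (simp add: height_def div_mod_shift[of k n, simplified])

lemma branch_size_shift:
  "0 < k \<Longrightarrow> k + 1 \<le> n \<Longrightarrow> branch_size n k i = Suc (branch_size (n - k) k i)"
  by (simp add: branch_size_def div_mod_shift[of k n, simplified])

abbreviation "bsverts n k \<equiv> sverts k (branch_size n k)"

lemma card_bsverts: "1 \<le> k \<Longrightarrow> 1 \<le> n \<Longrightarrow> card (bsverts n k) = n"
  by (simp add: card_sverts sum_branch_size)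

lemma balanced_starlike_BS:
  assumes "2 \<le> k" "k + 1 \<le> n"
  shows "balanced_starlike k (branch_size n k) (height n k)"
  by unfold_locales (use assms branch_size_pos[of k n] in
    \<open>auto simp: branch_size_le_height height_le_Suc_branch_size\<close>)

text \<open>All branches have at most one vertex, so the tree is a star of diameter at most 2. For
  \<open>n < k + 1\<close> some branches are empty; the induction on the order ends there,
  too.\<close>

lemma near_bsverts_full:
  assumes "1 \<le> k" "1 \<le> n" "n \<le> k + 1" "2 \<le> j"
  shows "near (bsverts n k) sdist j = n * n"
proof -
  have "(n - 1) div k = 0 \<or> (n - 1) div k = 1 \<and> (n - 1) mod k = 0"
  proof (cases "n - 1 = k")
    case False
    then have "n - 1 < k" using assms by simp
    then show ?thesis by simp
  qed (use assms in simp)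
  then have bs: "branch_size n k i \<le> 1" for i by (auto simp: branch_size_def)
  have "sdist x y \<le> j" if "x \<in> bsverts n k" "y \<in> bsverts n k" for x y
  proof -
    have "z = None \<or> (\<exists>i. z = Some (i, 0))" if "z \<in> bsverts n k" for z
    proof (cases z)
      case (Some ij)
      then obtain i b where z: "z = Some (i, b)" by (cases ij) auto
      with that have "b < branch_size n k i" by simp
      with bs[of i] have "b = 0" by linarith
      with z show ?thesis by blast
    qed simp
    from this[OF that(1)] this[OF that(2)] show ?thesis using assms(4) by auto
  qed
  then have "{(x, y) \<in> bsverts n k \<times> bsverts n k. sdist x y \<le> j} = bsverts n k \<times> bsverts n k" by auto
  then show ?thesis using assms by (simp add: near_def card_cartesian_product card_bsverts)
qed

lemma far_bsverts_Suc_Suc: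
  assumes "2 \<le> k" "k + 1 \<le> n" "height n k \<le> Suc j"
  shows "far (bsverts n k) sdist (Suc (Suc j)) = far (bsverts (n - k) k) sdist j"
proof -
  interpret balanced_starlike k "branch_size n k" "height n k"
    using assms balanced_starlike_BS by blast
  have "(\<lambda>i. branch_size n k i - 1) = branch_size (n - k) k"
    using branch_size_shift[of k n] assms by simp
  then show ?thesis using far_Suc_Suc_eq[OF assms(3)] by simp
qed

text \<open>After the leaves, further vertices are pruned until exactly \<open>k\<close> are gone,
  so that the rest is comparable with \<open>BS\<close> on \<open>card V - k\<close>
  vertices.\<close>

lemma exists_pruned_subtree:
  assumes "tree_metric V d" "card (leaves V d) \<le> k" "k \<le> card V"
  shows "\<exists>B. B \<subseteq> V - leaves V d \<and> card B = card V - k \<and> tree_metric B d \<and> card (leaves B d) \<le> k"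
proof -
  have "card (leaves V d) + (card V - k) \<le> card V" using assms(2,3) by simp
  from exists_subtree[OF assms(1) order_refl this] assms(2) show ?thesis by (meson order_trans)
qed

text \<open>An upper bound on the number of leaves, unlike a prescribed number of vertices of degree
  two, is preserved by pruning; this lets the induction on the order go through.\<close>

theorem near_le_near_BS:
  assumes "tree_metric V d" "V \<noteq> {}" "card (leaves V d) \<le> k" "2 \<le> k"
  shows "near V d j \<le> near (bsverts (card V) k) sdist j"
  using assms(1-3)
proof (induction "card V" arbitrary: V j rule: less_induct)
  case less
  define n where "n = card V"
  interpret tree_metric V d by fact
  interpret BS: tree_metric "bsverts n k" sdist by (rule tree_metric_starlike)
  have n: "1 \<le> n" using less.prems finite_V by (simp add: n_def Suc_le_eq card_gt_0_iff)
  have k: "1 \<le> k" using assms by simp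
  have cBS: "card (bsverts n k) = n" using card_bsverts[OF k n] .
  have near_le: "near V d i \<le> n * n" for i using near_plus_far[of i] by (simp add: n_def)
  have n1: "near V d 1 = near (bsverts n k) sdist 1"
    using near_1[OF less.prems(2)] BS.near_1 cBS n by (force simp: n_def)
  show ?case unfolding n_def[symmetric]
  proof (cases "n \<le> k + 1")
    \<comment> \<open>\<open>BS\<close> is a star here: all its distances are at most 2, and
      \<open>near_1\<close> gives all trees of the same order the same count.\<close>
    case True
    consider "j = 0" | "j = 1" | "2 \<le> j" by linarith
    then show "near V d j \<le> near (bsverts n k) sdist j"
    proof cases
      case 1
      then show ?thesis using near_0 BS.near_0 cBS by (simp add: n_def)
    next
      case 2
      then show ?thesis using n1 by simp
    next
      case 3
      then show ?thesis using near_bsverts_full[OF k n True 3] near_le by simp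
    qed
  next
    case False
    interpret bal: balanced_starlike k "branch_size n k" "height n k"
      using assms False by (intro balanced_starlike_BS) auto
    have hn: "height n k \<le> n - 1" using height_le k by simp
    show "near V d j \<le> near (bsverts n k) sdist j"
    proof (cases "j \<le> height n k")
      \<comment> \<open>Up to the length of the longest branch the increments are compared: the
        bound of \<open>near_Suc_le\<close> is the value of \<open>near_Suc_eq\<close>.\<close>
      case True
      then show ?thesis
      proof (induction j)
        case 0
        then show ?case using near_0 BS.near_0 cBS by (simp add: n_def)
      next
        case (Suc j)
        have "Suc j \<le> card V" using Suc.prems hn n by (simp add: n_def)
        then have "int (near V d (Suc j)) \<le> int (near (bsverts n k) sdist (Suc j))"
          using near_Suc_le[of k j] bal.near_Suc_eq[of j] Suc less.prems(3) False assms(4) cBS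
          by (simp add: n_def)
        then show ?case by simp
      qed
    next
      \<comment> \<open>Beyond the longest branch the far pairs are compared through the pruned
        trees on \<open>n - k\<close> vertices, at distance \<open>j - 2\<close>.\<close>
      case False
      note j = this
      have hs: "height n k = Suc (height (n - k) k)"
        using height_shift[of k n] k \<open>\<not> n \<le> k + 1\<close> by simp
      then have "2 \<le> j" using j by simp
      then obtain e where "j = 2 + e" using le_Suc_ex by blast
      then have e: "j = Suc (Suc e)" by simp
      obtain B where B: "B \<subseteq> V - leaves V d" "card B = n - k" "tree_metric B d" "card (leaves B d) \<le> k"
        using exists_pruned_subtree[OF less.prems(1,3)] \<open>\<not> n \<le> k + 1\<close> by (auto simp: n_def)
      have "B \<noteq> {}" using B \<open>\<not> n \<le> k + 1\<close> by auto
      then have "near B d e \<le> near (bsverts (n - k) k) sdist e"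
        using less.hyps[OF _ B(3) _ B(4), of e] B(2) k n by (simp add: n_def)
      moreover have "near B d e + far B d e = (n - k) * (n - k)"
        using tree_metric.near_plus_far[OF B(3)] B(2) by simp
      moreover have "near (bsverts (n - k) k) sdist e + far (bsverts (n - k) k) sdist e = (n - k) * (n - k)"
        using tree_metric.near_plus_far[OF tree_metric_starlike] card_bsverts[of k "n - k"] k \<open>\<not> n \<le> k + 1\<close>
        by simp
      ultimately have "far (bsverts (n - k) k) sdist e \<le> far B d e" by simp
      also have "\<dots> \<le> far V d j" using far_le_far_Suc_Suc[OF B(1)] e by simp
      finally have "far (bsverts n k) sdist j \<le> far V d j"
        using far_bsverts_Suc_Suc[of k n e] assms(4) \<open>\<not> n \<le> k + 1\<close> j e by simp
      then show ?thesis
        using near_plus_far[of j] BS.near_plus_far[of j] cBS by (simp add: n_def)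
    qed
  qed
qed

section \<open>The case of equality\<close>

context tree_metric
begin

lemma deg_le_card_leaves:
  assumes "x \<in> V" "2 \<le> card V"
  shows "deg V d x \<le> card (leaves V d)"
  using card_disc_step[OF assms(1), of 0] card_disc_step_le[OF assms, of 0]
  by (simp add: disc_0 assms)

lemma card_disc_1: "x \<in> V \<Longrightarrow> card (disc V d x 1) = 1 + deg V d x"
  using card_disc_step[of x 0] by (simp add: disc_0)

text \<open>Equal counts fix the sum of \<open>(deg - 2) (deg + 1)\<close>. If all degrees were
  below \<open>k\<close>, every nonleaf factor \<open>deg + 1\<close> would be at most
  \<open>k\<close>; to reach the sum, more than \<open>k\<close> leaves would then be
  necessary.\<close>

lemma exists_center:
  assumes "3 \<le> k" "k + 1 \<le> card V" "card (leaves V d) \<le> k"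
    and "near V d 2 = near (bsverts (card V) k) sdist 2"
  shows "\<exists>c\<in>V. deg V d c = k"
proof (rule ccontr)
  assume no: "\<not> ?thesis"
  interpret bal: balanced_starlike k "branch_size (card V) k" "height (card V) k"
    using assms by (intro balanced_starlike_BS) auto
  have cV: "2 \<le> card V" "V \<noteq> {}" using assms by auto
  let ?L = "int (card (leaves V d))"
  have cBS: "card (bsverts (card V) k) = card V" using assms by (simp add: card_bsverts)
  then have "near V d 1 = near (bsverts (card V) k) sdist 1"
    using near_1[OF cV(2)] bal.near_1 assms by force
  moreover have "int (near V d 2) = int (near V d 1) + 2 * int (card V) +
      (\<Sum>y\<in>V. (int (deg V d y) - 2) * (1 + int (deg V d y)))"
    using near_Suc[of 1] card_disc_1 by (simp add: numeral_2_eq_2)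
  ultimately have "(\<Sum>y\<in>V. (int (deg V d y) - 2) * (1 + int (deg V d y))) =
      (int k - 2) * (1 + int k) - 2 * int k"
    using bal.near_2 assms(4) cBS by simp
  moreover have "(\<Sum>y\<in>leaves V d. 1 + int (deg V d y)) = 2 * ?L"
  proof -
    have "1 + int (deg V d y) = 2" if "y \<in> leaves V d" for y
      using that deg_pos[of y] cV by (force simp: leaves_def)
    then show ?thesis by simp
  qed
  moreover have "(\<Sum>y\<in>V - leaves V d. (int (deg V d y) - 2) * (1 + int (deg V d y)))
      \<le> (\<Sum>y\<in>V - leaves V d. (int (deg V d y) - 2) * int k)"
  proof (intro sum_mono mult_left_mono)
    fix y assume y: "y \<in> V - leaves V d"
    then show "0 \<le> int (deg V d y) - 2" by (auto simp: leaves_def)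
    have "deg V d y \<le> k" "deg V d y \<noteq> k"
      using y no deg_le_card_leaves[of y] cV assms(3) by auto
    then show "1 + int (deg V d y) \<le> int k" by simp
  qed
  moreover have "(\<Sum>y\<in>V - leaves V d. (int (deg V d y) - 2) * int k) = (?L - 2) * int k"
    by (simp only: sum_distrib_right[symmetric] sum_excess[OF cV(1)])
  ultimately have "(int k - 2) * (1 + int k) - 2 * int k \<le> (?L - 2) * int k - 2 * ?L"
    using sum_split_leaves[OF cV(1), of "\<lambda>y. 1 + int (deg V d y)"] by linarith
  then have "(int k - 2) * (1 + int k) \<le> (int k - 2) * ?L" by (simp add: algebra_simps)
  then have "1 + int k \<le> ?L" using assms(1) by simp
  then show False using assms(3) by simp
qed

text \<open>The vertex \<open>c\<close> uses up the whole excess \<open>k - 2\<close>, so nothing is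
  left for the other nonleaves.\<close>

lemma card_leaves_and_deg_le_2:
  assumes "c \<in> V" "deg V d c = k" "3 \<le> k" "2 \<le> card V" "card (leaves V d) \<le> k"
  shows "card (leaves V d) = k" and "\<And>x. x \<in> V \<Longrightarrow> x \<noteq> c \<Longrightarrow> deg V d x \<le> 2"
proof -
  show L: "card (leaves V d) = k"
    using deg_le_card_leaves[OF assms(1,4)] assms by simp
  fix x assume x: "x \<in> V" "x \<noteq> c"
  have c: "c \<in> V - leaves V d" using assms by (auto simp: leaves_def)
  have "(\<Sum>y\<in>V - leaves V d - {c}. int (deg V d y) - 2) = 0"
    using sum_excess[OF assms(4)] assms(2) L
    by (subst (asm) sum.remove[OF _ c]) (auto simp: finite_V)
  moreover have "\<And>y. y \<in> V - leaves V d - {c} \<Longrightarrow> 0 \<le> int (deg V d y) - 2"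
    by (auto simp: leaves_def)
  moreover have "finite (V - leaves V d - {c})" by (simp add: finite_V)
  ultimately have eq: "\<forall>y\<in>V - leaves V d - {c}. int (deg V d y) - 2 = 0"
    by (subst (asm) sum_nonneg_eq_0_iff) blast+
  show "deg V d x \<le> 2"
  proof (cases "x \<in> leaves V d")
    case True
    then show ?thesis by (simp add: leaves_def)
  next
    case False
    then have "int (deg V d x) - 2 = 0" using eq x by blast
    then show ?thesis by simp
  qed
qed

end

text \<open>What the equality case leaves once a vertex of degree \<open>k\<close> is found:
  \<open>k\<close> paths, called legs below, issuing from \<open>c\<close>.\<close>

locale spider = tree_metric +
  fixes c :: 'a and k :: nat
  assumes c_in: "c \<in> V" and deg_c: "deg V d c = k" and three_le_k: "3 \<le> k"
    and deg_le_2: "\<And>x. x \<in> V \<Longrightarrow> x \<noteq> c \<Longrightarrow> deg V d x \<le> 2"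
    and card_leaves: "card (leaves V d) = k"
begin

lemma two_le_card: "2 \<le> card V"
proof -
  have "nbrs V d c \<subseteq> V" by (auto simp: nbrs_def)
  then have "k \<le> card V" unfolding deg_c[symmetric] deg_def by (rule card_mono[OF finite_V])
  then show ?thesis using three_le_k by simp
qed

lemma sum_deg_minus_2:
  fixes f :: "'a \<Rightarrow> int"
  shows "(\<Sum>y\<in>V. (int (deg V d y) - 2) * f y) = (int k - 2) * f c - (\<Sum>y\<in>leaves V d. f y)"
proof -
  have c: "c \<in> V - leaves V d" using c_in deg_c three_le_k by (auto simp: leaves_def)
  have "deg V d y = 2" if "y \<in> V - leaves V d - {c}" for y
    using that deg_le_2[of y] by (auto simp: leaves_def)
  then have "(\<Sum>y\<in>V - leaves V d. (int (deg V d y) - 2) * f y) = (int k - 2) * f c"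
    by (subst sum.remove[OF _ c]) (auto simp: finite_V deg_c)
  then show ?thesis using sum_split_leaves[OF two_le_card, of f] by simp
qed

text \<open>The increment at \<open>j\<close> equals that of \<open>BS\<close>, and the leaves
  subtract at least as much as there; so the ball around \<open>c\<close> must have the largest
  possible size. In other words, no leg has fewer than \<open>j\<close> vertices.\<close>

lemma card_disc_center:
  assumes "k + 1 \<le> card V" "height (card V) k = Suc j"
    and near: "\<And>j. near V d j = near (bsverts (card V) k) sdist j"
  shows "card (disc V d c j) = 1 + k * j"
proof -
  interpret bal: balanced_starlike k "branch_size (card V) k" "height (card V) k"
    using assms three_le_k by (intro balanced_starlike_BS) auto
  have "Suc j \<le> card V" using height_le[of k "card V"] assms(2) three_le_k by simp
  note leaf = card_disc_leaf_ge[OF this]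
  have "card (bsverts (card V) k) = card V" using assms three_le_k by (simp add: card_bsverts)
  then have "(\<Sum>y\<in>V. (int (deg V d y) - 2) * int (card (disc V d y j))) =
      (int k - 2) * (1 + int k * int j) - int k * (int j + 1)"
    using near_Suc[of j] bal.near_Suc_eq[of j] assms(2) near by simp
  then have "(int k - 2) * (1 + int k * int j) \<le> (int k - 2) * int (card (disc V d c j))"
    using leaf unfolding sum_deg_minus_2 card_leaves by linarith
  then have "1 + int k * int j \<le> int (card (disc V d c j))" using three_le_k by simp
  then have "1 + k * j \<le> card (disc V d c j)" by (simp flip: of_nat_mult)
  moreover have "card (disc V d c j) \<le> 1 + k * j"
    using card_disc_le[OF c_in two_le_card] card_leaves by simp
  ultimately show ?thesis by simp
qed

text \<open>Equal far counts rule out the strict inequality of \<open>far_less_far_Suc_Suc\<close>,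
  so nonleaves stay at least one step below the height; a leaf lies one step beyond its nonleaf
  neighbour.\<close>

lemma dist_center_le:
  assumes n: "k + 1 \<le> card V"
    and near: "\<And>j. near V d j = near (bsverts (card V) k) sdist j"
    and x: "x \<in> V"
  shows "d c x \<le> height (card V) k"
proof -
  let ?n = "card V"
  have hs: "height ?n k = Suc (height (?n - k) k)"
    using height_shift[of k ?n] three_le_k n by simp
  show ?thesis
  proof (cases "?n = k + 1")
    case True
    then have "card (disc V d c 1) = card V" using card_disc_1[OF c_in] deg_c by simp
    then have "disc V d c 1 = V" by (intro card_subset_eq finite_V) (auto simp: disc_def)
    then have "d c x \<le> 1" using x unfolding disc_def by blast
    then show ?thesis using hs by simp
  next
    case False
    define j where "j = height (?n - k) k"
    obtain B where B: "B \<subseteq> V - leaves V d" "card B = ?n - k" "tree_metric B d" "card (leaves B d) \<le> k"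
      using exists_pruned_subtree[of V d k] tree_metric_axioms card_leaves n by auto
    have sub: "leaves V d \<subseteq> V" by (auto simp: leaves_def)
    then have "card (V - leaves V d) = ?n - k"
      using card_leaves finite_V by (simp add: card_Diff_subset finite_subset)
    \<comment> \<open>With exactly \<open>k\<close> leaves, pruning \<open>k\<close> vertices
      removes the leaves and nothing else.\<close>
    then have BV: "B = V - leaves V d"
      using B by (intro card_subset_eq) (auto simp: finite_V)
    have cB: "card (bsverts (?n - k) k) = ?n - k" using three_le_k n by (simp add: card_bsverts)
    have cBS: "card (bsverts ?n k) = ?n" using three_le_k n by (simp add: card_bsverts)
    have "B \<noteq> {}" using B(2) n by auto
    then have "near B d j \<le> near (bsverts (?n - k) k) sdist j"
      using near_le_near_BS[OF B(3) _ B(4), of j] three_le_k B(2) by simp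
    moreover have "near B d j + far B d j = (?n - k) * (?n - k)"
      using tree_metric.near_plus_far[OF B(3)] B(2) by simp
    moreover have "near (bsverts (?n - k) k) sdist j + far (bsverts (?n - k) k) sdist j = (?n - k) * (?n - k)"
      using tree_metric.near_plus_far[OF tree_metric_starlike] cB by simp
    ultimately have "far (bsverts (?n - k) k) sdist j \<le> far B d j" by simp
    moreover have "far (bsverts ?n k) sdist (Suc (Suc j)) = far (bsverts (?n - k) k) sdist j"
      by (rule far_bsverts_Suc_Suc) (use three_le_k n hs in \<open>auto simp: j_def\<close>)
    moreover have "far V d (Suc (Suc j)) = far (bsverts ?n k) sdist (Suc (Suc j))"
      using near_plus_far[of "Suc (Suc j)"] near[of "Suc (Suc j)"] cBS
        tree_metric.near_plus_far[OF tree_metric_starlike, of k "branch_size ?n k" "Suc (Suc j)"]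
      by simp
    ultimately have "\<not> far B d j < far V d (Suc (Suc j))" by simp
    then have nonleaf: "d c y \<le> j" if "y \<in> V - leaves V d" for y
      using far_less_far_Suc_Suc[OF c_in _ that, of j] deg_c three_le_k unfolding BV
      by (meson not_le)
    show ?thesis
    proof (cases "x = c")
      case False
      then obtain p where p: "p \<in> V" "d x p = 1" "d c x = Suc (d c p)"
        using parentE[OF c_in x] by blast
      have "2 \<le> deg V d p"
        using deg_ge_2_between[OF c_in x p] deg_c three_le_k by (cases "c = p") auto
      then have "d c p \<le> j" using p(1) by (intro nonleaf) (auto simp: leaves_def)
      then show ?thesis using p(3) hs by (simp add: j_def)
    qed (simp add: dist_self c_in)
  qed
qed

text \<open>The leg that contains \<open>v\<close> is named by its first vertex, obtained as the
  parent of \<open>c\<close> seen from \<open>v\<close>. For \<open>v = c\<close> the choice is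
  arbitrary.\<close>

definition anc :: "'a \<Rightarrow> 'a" where
  "anc v = (SOME x. x \<in> V \<and> d c x = 1 \<and> d v c = Suc (d v x))"

lemma anc:
  assumes "v \<in> V" "v \<noteq> c"
  shows "anc v \<in> V" "d c (anc v) = 1" "d v c = Suc (d v (anc v))"
proof -
  have "\<exists>x. x \<in> V \<and> d c x = 1 \<and> d v c = Suc (d v x)"
    using parentE[OF assms(1) c_in assms(2)] by metis
  from someI_ex[OF this] show "anc v \<in> V" "d c (anc v) = 1" "d v c = Suc (d v (anc v))"
    unfolding anc_def by auto
qed

lemma anc_eqI:
  assumes "v \<in> V" "x \<in> V" "d c x = 1" "d v c = Suc (d v x)"
  shows "anc v = x"
proof -
  have "v \<noteq> c" using assms dist_self by force
  with anc[OF assms(1)] assms c_in show ?thesis by (intro parent_unique[of v c]) auto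
qed

text \<open>Distances to the two ends of an edge differ by exactly one. Applied to the edge between
  \<open>p\<close> and \<open>v\<close> and to the edge between \<open>c\<close> and
  \<open>anc p\<close>, this leaves a single value for \<open>d v (anc p)\<close>.\<close>

lemma anc_parent:
  assumes "v \<in> V" "p \<in> V" "p \<noteq> c" "d v p = 1" "d c v = Suc (d c p)"
  shows "anc v = anc p"
proof (rule anc_eqI)
  note a = anc[OF assms(2,3)]
  show "anc p \<in> V" "d c (anc p) = 1" using a by auto
  have "d (anc p) v = Suc (d (anc p) p) \<or> d (anc p) p = Suc (d (anc p) v)"
    using dist_nbr[of "anc p" p v] a assms by (simp add: dist_commute)
  moreover have "d v (anc p) = Suc (d v c) \<or> d v c = Suc (d v (anc p))"
    using dist_nbr[of v c "anc p"] a assms c_in by simp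
  moreover have "d (anc p) v = d v (anc p)" "d (anc p) p = d p (anc p)" "d v c = d c v" "d p c = d c p"
    using a assms c_in by (simp_all only: dist_commute)
  ultimately show "d v c = Suc (d v (anc p))"
    using a(3) assms(5) by presburger
qed (rule assms)

text \<open>Two distinct vertices on the same leg at the same depth above 1 would, by induction,
  share their parent \<open>p\<close>, which has a third neighbour towards \<open>c\<close> and thus
  degree at least 3.\<close>

lemma anc_inj:
  assumes "v \<in> V" "v' \<in> V" "v \<noteq> c" "v' \<noteq> c" "anc v = anc v'" "d c v = d c v'"
  shows "v = v'"
  using assms
proof (induction "d c v" arbitrary: v v')
  case 0
  then show ?case using dist_eq_0_iff[OF c_in] by metis
next
  case (Suc e)
  obtain p where p: "p \<in> V" "d v p = 1" "d c v = Suc (d c p)"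
    using parentE[OF c_in Suc.prems(1)] Suc.prems by metis
  obtain p' where p': "p' \<in> V" "d v' p' = 1" "d c v' = Suc (d c p')"
    using parentE[OF c_in Suc.prems(2)] Suc.prems by metis
  show ?case
  proof (cases "e = 0")
    case True
    have "anc w = w" if "w \<in> V" "d c w = 1" for w
      using that c_in by (intro anc_eqI) (auto simp: dist_self dist_commute)
    then show ?thesis using Suc True by simp
  next
    case False
    have pc: "p \<noteq> c" "p' \<noteq> c" using False Suc p p' dist_self[OF c_in] by auto
    have "p = p'"
      using Suc.hyps(1)[of p p'] Suc.hyps(2) Suc.prems p p' pc anc_parent[of v p] anc_parent[of v' p']
      by simp
    obtain r where r: "r \<in> V" "d p r = 1" "d c p = Suc (d c r)"
      using parentE[OF c_in p(1)] pc by metis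
    show ?thesis
    proof (rule ccontr)
      assume "v \<noteq> v'"
      moreover have "r \<noteq> v" "r \<noteq> v'" using r p p' \<open>p = p'\<close> by auto
      ultimately have "card {r, v, v'} = 3" by simp
      moreover have "{r, v, v'} \<subseteq> nbrs V d p"
        using r p p' Suc.prems \<open>p = p'\<close> by (auto simp: nbrs_def dist_commute)
      then have "card {r, v, v'} \<le> deg V d p" unfolding deg_def by (rule card_mono[rotated]) simp
      ultimately show False using deg_le_2[OF p(1) pc(1)] by simp
    qed
  qed
qed

end

text \<open>The legs of full length are to receive the initial numbers, because
  \<open>branch_size\<close> gives the longer branches the smaller indices.\<close>

lemma ex_labelling:
  assumes "finite N" "A \<subseteq> N"
  shows "\<exists>a. bij_betw a N {..<card N} \<and> a ` A = {..<card A}"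
proof -
  have finA: "finite A" using assms finite_subset by blast
  obtain f where f: "bij_betw f A {..<card A}"
    using ex_bij_betw_finite_nat[OF finA] by (auto simp: atLeast0LessThan)
  have "card (N - A) = card {card A..<card N}" using assms finA by (simp add: card_Diff_subset)
  then obtain g where g: "bij_betw g (N - A) {card A..<card N}"
    using finite_same_card_bij[of "N - A" "{card A..<card N}"] assms by auto
  let ?a = "\<lambda>x. if x \<in> A then f x else g x"
  have "bij_betw ?a A {..<card A}" using f by (subst bij_betw_cong[of A ?a f]) auto
  moreover have "bij_betw ?a (N - A) {card A..<card N}"
    using g by (subst bij_betw_cong[of "N - A" ?a g]) auto
  ultimately have "bij_betw ?a (A \<union> (N - A)) ({..<card A} \<union> {card A..<card N})"
    by (rule bij_betw_combine) auto
  moreover have "A \<union> (N - A) = N" using assms by blast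
  moreover have "{..<card A} \<union> {card A..<card N} = {..<card N}"
    using card_mono[OF assms] by auto
  ultimately have "bij_betw ?a N {..<card N}" by simp
  then show ?thesis
    using bij_betw_imp_surj_on[OF \<open>bij_betw ?a A {..<card A}\<close>] by blast
qed

section \<open>The isomorphism with the balanced starlike tree\<close>

context spider
begin

lemma isomorphic_to_BS:
  assumes n: "k + 1 \<le> card V"
    and near: "\<And>j. near V d j = near (bsverts (card V) k) sdist j"
  shows "\<exists>h. bij_betw h V (bsverts (card V) k) \<and>
    (\<forall>x\<in>V. \<forall>y\<in>V. d x y = 1 \<longleftrightarrow> sdist (h x) (h y) = 1)"
proof -
  let ?n = "card V" and ?W = "bsverts (card V) k"
  interpret BS: tree_metric ?W sdist by (rule tree_metric_starlike)
  define m where "m = height ?n k"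
  have k: "0 < k" using three_le_k by simp
  obtain j where j: "m = Suc j" using height_shift[OF k n] by (auto simp: m_def)
  \<comment> \<open>The ends of the legs that reach the maximal depth \<open>m\<close>, at most one
    on each leg.\<close>
  define E where "E = {v \<in> V. d c v = m}"
  have "E = V - disc V d c j"
    using dist_center_le[OF n near] j by (force simp: E_def disc_def m_def)
  then have cE: "card E = ?n - (1 + k * j)"
    using card_disc_center[OF n _ near, of j] j finite_V
    by (simp add: m_def card_Diff_subset disc_def)
  have inj_anc: "inj_on anc E"
    by (rule inj_onI, rule anc_inj) (use j c_in dist_self in \<open>auto simp: E_def\<close>)
  have ancN: "anc v \<in> nbrs V d c" if "v \<in> V" "v \<noteq> c" for v
    using anc[OF that] by (simp add: nbrs_def)
  have Ec: "v \<in> V" "v \<noteq> c" if "v \<in> E" for v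
    using that j c_in dist_self by (auto simp: E_def)
  have "anc ` E \<subseteq> nbrs V d c" using ancN Ec by blast
  then obtain a where a: "bij_betw a (nbrs V d c) {..<k}" "a ` (anc ` E) = {..<card E}"
    using ex_labelling[of "nbrs V d c" "anc ` E"] deg_c card_image[OF inj_anc]
    unfolding deg_def by auto
  \<comment> \<open>If \<open>k\<close> divides \<open>n - 1\<close>, all branches have
    \<open>m\<close> vertices; otherwise \<open>card E = n - 1 - k * j\<close> is the remainder,
    which is the number of long branches.\<close>
  have long: "branch_size ?n k i = m" if "i < card E" for i
  proof (cases "(?n - 1) mod k = 0")
    case False
    then have "(?n - 1) div k = j" using j by (simp add: m_def height_def)
    then have "?n - 1 = k * j + (?n - 1) mod k" by (metis mult_div_mod_eq)
    then have "card E = (?n - 1) mod k" using cE by linarith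
    then show ?thesis using that False by (simp add: branch_size_def m_def height_def)
  qed (simp add: branch_size_def m_def height_def)
  \<comment> \<open>Depth \<open>d c v\<close> becomes position \<open>d c v - 1\<close>, as
    positions on a branch start with 0 next to the centre.\<close>
  define h where "h v = (if v = c then None else Some (a (anc v), d c v - 1))" for v
  have depth: "0 < d c v" if "v \<in> V" "v \<noteq> c" for v
    using that dist_eq_0_iff[OF c_in] by (metis gr0I)
  have a_lt: "a (anc v) < k" if "v \<in> V" "v \<noteq> c" for v
    using a(1) ancN[OF that] by (auto simp: bij_betw_def)
  have hW: "h v \<in> ?W" if v: "v \<in> V" for v
  proof (cases "v = c")
    case False
    have "d c v - 1 < branch_size ?n k (a (anc v))"
    proof (cases "d c v = m")
      case True
      then have "a (anc v) < card E" using v a(2) by (auto simp: E_def)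
      then show ?thesis using long True depth[OF v False] by simp
    next
      case neq: False
      then have "d c v < m" using dist_center_le[OF n near v] by (simp add: m_def)
      then show ?thesis
        using height_le_Suc_branch_size[of ?n k "a (anc v)"] depth[OF v False] by (simp add: m_def)
    qed
    then show ?thesis using False a_lt[OF v False] by (simp add: h_def)
  qed (simp add: h_def)
  have inj: "inj_on h V"
  proof (rule inj_onI)
    fix v w assume vw: "v \<in> V" "w \<in> V" "h v = h w"
    show "v = w"
    proof (cases "v = c \<or> w = c")
      case False
      then have "a (anc v) = a (anc w)" "d c v - 1 = d c w - 1" using vw by (auto simp: h_def)
      moreover have "0 < d c v" "0 < d c w" using depth vw False by auto
      ultimately have "d c v = d c w" "anc v = anc w"
        using a(1) ancN vw False by (auto simp: bij_betw_def dest: inj_onD)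
      then show ?thesis using anc_inj vw False by blast
    qed (use vw in \<open>auto simp: h_def split: if_splits\<close>)
  qed
  have "card ?W = ?n" using k n by (simp add: card_bsverts)
  then have "h ` V = ?W"
    using hW inj by (intro card_subset_eq) (auto simp: card_image)
  with inj have bij: "bij_betw h V ?W" by (simp add: bij_betw_def)
  have up: "sdist (h p) (h y) = 1" if "p \<in> V" "y \<in> V" "d y p = 1" "d c y = Suc (d c p)" for p y
  proof (cases "p = c")
    case True
    then have "d c y = 1" using that dist_self[OF c_in] by simp
    moreover have "y \<noteq> c" using that dist_self[OF c_in] by auto
    ultimately show ?thesis using True by (simp add: h_def)
  next
    case False
    have "y \<noteq> c" using that dist_self[OF c_in] by auto
    moreover have "anc y = anc p" by (rule anc_parent) (use that False in auto)
    ultimately show ?thesis using False that depth[OF that(1) False] by (simp add: h_def)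
  qed
  have h_depth: "sdist None (h v) = d c v" if "v \<in> V" for v
    using depth[OF that] dist_self[OF c_in] by (simp add: h_def)
  \<comment> \<open>By \<open>up\<close> the parent of \<open>y\<close> is mapped to a parent of
    \<open>h y\<close> seen from the centre; so is \<open>x\<close>, and parents are unique.\<close>
  have down: "d x y = 1"
    if "x \<in> V" "y \<in> V" "sdist (h y) (h x) = 1" "d c y = Suc (d c x)" for x y
  proof -
    have "y \<noteq> c" using that dist_self[OF c_in] by auto
    then obtain p where p: "p \<in> V" "d y p = 1" "d c y = Suc (d c p)"
      using parentE[OF c_in \<open>y \<in> V\<close>] by metis
    have "sdist (h y) (h p) = 1" using up[OF p(1) that(2) p(2,3)] by (simp add: sdist_commute)
    then have "h p = h x"
      using BS.parent_unique[of None "h y" "h p" "h x"] hW p that by (simp add: h_depth)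
    then have "p = x" using inj p that by (auto dest: inj_onD)
    then show ?thesis using p that by (simp add: dist_commute)
  qed
  have "d x y = 1 \<longleftrightarrow> sdist (h x) (h y) = 1" if xy: "x \<in> V" "y \<in> V" for x y
  proof
    assume "d x y = 1"
    then show "sdist (h x) (h y) = 1"
      using dist_nbr[OF c_in xy] up[of x y] up[of y x] xy by (auto simp: dist_commute sdist_commute)
  next
    assume s: "sdist (h x) (h y) = 1"
    have "d c y = Suc (d c x) \<or> d c x = Suc (d c y)"
      using BS.dist_nbr[of None "h x" "h y"] hW xy s by (simp add: h_depth)
    then show "d x y = 1"
      using down[of x y] down[of y x] xy s by (auto simp: dist_commute sdist_commute)
  qed
  with bij show ?thesis by blast
qed

end

theorem near_eq_imp_isomorphic_to_BS:
  assumes "tree_metric V d" "3 \<le> k" "k + 1 \<le> card V" "card (leaves V d) \<le> k"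
    and near: "\<And>j. near V d j = near (bsverts (card V) k) sdist j"
  shows "\<exists>h. bij_betw h V (bsverts (card V) k) \<and>
    (\<forall>x\<in>V. \<forall>y\<in>V. d x y = 1 \<longleftrightarrow> sdist (h x) (h y) = 1)"
proof -
  interpret tree_metric V d by fact
  obtain c where c: "c \<in> V" "deg V d c = k" using exists_center[OF assms(2-4) near] by blast
  interpret spider V d c k
    by unfold_locales (use c assms card_leaves_and_deg_le_2[OF c] in auto)
  show ?thesis by (rule isomorphic_to_BS[OF assms(3) near])
qed

section \<open>Trees as graphs\<close>

text \<open>Induction along the parents with respect to \<open>d\<close>: each step is an edge,
  which increases \<open>d'\<close> by at most one.\<close>

lemma tree_metric_le:
  assumes "tree_metric V d" "tree_metric V d'"
    and adj: "\<And>x y. x \<in> V \<Longrightarrow> y \<in> V \<Longrightarrow> d x y = 1 \<longleftrightarrow> d' x y = 1"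
    and "x \<in> V" "y \<in> V"
  shows "d' x y \<le> d x y"
  using \<open>y \<in> V\<close>
proof (induction "d x y" arbitrary: y)
  case 0
  then have "x = y" using tree_metric.dist_eq_0_iff[OF assms(1) \<open>x \<in> V\<close>, of y] by simp
  then show ?case using tree_metric.dist_self[OF assms(2)] 0 by simp
next
  case (Suc e)
  then have "x \<noteq> y" using tree_metric.dist_self[OF assms(1) \<open>x \<in> V\<close>] by auto
  then obtain p where p: "p \<in> V" "d y p = 1" "d x y = Suc (d x p)"
    using tree_metric.parentE[OF assms(1) \<open>x \<in> V\<close> \<open>y \<in> V\<close>] by metis
  have "d' p y = 1"
    using p Suc.prems adj[of y p] tree_metric.dist_commute[OF assms(2), of y p] by simp
  then have "d' x y \<le> Suc (d' x p)"
    using tree_metric.dist_nbr[OF assms(2) \<open>x \<in> V\<close> p(1) Suc.prems] by auto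
  also have "d' x p \<le> d x p" using Suc p by auto
  finally show ?case using p by simp
qed

text \<open>The tool that identifies \<open>sdist\<close> and transported metrics with graph
  distances: only adjacency has to be compared.\<close>

lemma tree_metric_unique:
  assumes "tree_metric V d" "tree_metric V d'"
    and "\<And>x y. x \<in> V \<Longrightarrow> y \<in> V \<Longrightarrow> d x y = 1 \<longleftrightarrow> d' x y = 1"
    and "x \<in> V" "y \<in> V"
  shows "d x y = d' x y"
  using tree_metric_le[of V d d' x y] tree_metric_le[of V d' d x y] assms by (intro antisym) auto

lemma tree_metric_vimage:
  assumes "tree_metric W d" "bij_betw h V W"
  shows "tree_metric V (\<lambda>x y. d (h x) (h y))"
proof
  interpret W: tree_metric W d by fact
  have hV: "h x \<in> W" if "x \<in> V" for x using assms(2) that by (auto simp: bij_betw_def)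
  have h_eq: "h x = h y \<longleftrightarrow> x = y" if "x \<in> V" "y \<in> V" for x y
    using assms(2) that by (auto simp: bij_betw_def inj_on_eq_iff)
  show "finite V" using assms(2) W.finite_V bij_betw_finite by blast
  show "d (h x) (h y) = 0 \<longleftrightarrow> x = y" if "x \<in> V" "y \<in> V" for x y
    using W.dist_eq_0_iff hV h_eq that by simp
  show "d (h x) (h y) = d (h y) (h x)" if "x \<in> V" "y \<in> V" for x y
    using W.dist_commute hV that by simp
  fix x y assume xy: "x \<in> V" "y \<in> V" "x \<noteq> y"
  then obtain p' where p': "p' \<in> W" "d (h y) p' = 1" "d (h x) (h y) = Suc (d (h x) p')"
    "\<And>z. z \<in> W \<Longrightarrow> d (h y) z = 1 \<Longrightarrow> z \<noteq> p' \<Longrightarrow> d (h x) z = Suc (d (h x) (h y))"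
    using W.parentE[of "h x" "h y"] hV h_eq by blast
  then obtain p where p: "p \<in> V" "p' = h p" using assms(2) by (auto simp: bij_betw_def)
  then have "\<forall>z\<in>V. d (h y) (h z) = 1 \<and> z \<noteq> p \<longrightarrow> d (h x) (h z) = Suc (d (h x) (h y))"
    using p'(4) hV h_eq by blast
  then show "\<exists>p\<in>V. d (h y) (h p) = 1 \<and> d (h x) (h y) = Suc (d (h x) (h p)) \<and>
      (\<forall>z\<in>V. d (h y) (h z) = 1 \<and> z \<noteq> p \<longrightarrow> d (h x) (h z) = Suc (d (h x) (h y)))"
    using p p' by blast
qed

text \<open>A natural-number version of \<open>graph_dist\<close>, as \<open>tree_metric\<close>
  demands; it is meaningful for vertices joined by a walk.\<close>

definition gdist :: "'a pair_pre_digraph \<Rightarrow> 'a \<Rightarrow> 'a \<Rightarrow> nat" where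
  "gdist G x y = (LEAST n. \<exists>p. pre_digraph.awalk (with_proj G) x p y \<and> length p = n)"

section \<open>Shortest walks and tree metrics\<close>

context pair_graph
begin

lemma awalk_cost_1: "awalk_cost (\<lambda>_. 1) p = real (length p)"
  by (induction p) auto

lemma gdist_le: "awalk x p y \<Longrightarrow> gdist G x y \<le> length p"
  unfolding gdist_def by (rule Least_le) blast

lemma gdist_walk:
  assumes "awalk x q y"
  obtains p where "awalk x p y" "length p = gdist G x y"
proof -
  have "\<exists>n p. awalk x p y \<and> length p = n" using assms by blast
  from LeastI_ex[OF this] that show ?thesis unfolding gdist_def by blast
qed

lemma graph_dist_eq_gdist:
  assumes "awalk x q y"
  shows "graph_dist G x y = real (gdist G x y)"
proof -
  obtain p where p: "awalk x p y" "length p = gdist G x y" using gdist_walk[OF assms] .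
  have "\<mu> (\<lambda>_. 1) x y = ereal (real (gdist G x y))"
  proof (rule antisym)
    show "\<mu> (\<lambda>_. 1) x y \<le> ereal (real (gdist G x y))"
      using min_cost_le_walk_cost[OF p(1), of "\<lambda>_. 1"] p(2) by (simp add: awalk_cost_1)
    show "ereal (real (gdist G x y)) \<le> \<mu> (\<lambda>_. 1) x y"
      unfolding \<mu>_def by (rule INF_greatest) (auto simp: awalk_cost_1 gdist_le)
  qed
  then show ?thesis by (simp add: graph_dist_def)
qed

lemma gdist_self: "x \<in> pverts G \<Longrightarrow> gdist G x x = 0"
  using gdist_le[of x "[]" x] by (simp add: awalk_Nil_iff)

lemma gdist_eq_0_D:
  assumes "awalk x q y" "gdist G x y = 0"
  shows "x = y"
proof -
  obtain p where "awalk x p y" "length p = gdist G x y" using gdist_walk[OF assms(1)] .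
  then show ?thesis using assms(2) by (auto simp: awalk_Nil_iff)
qed

lemma gdist_commute_le:
  assumes "awalk x q y"
  shows "gdist G y x \<le> gdist G x y"
proof -
  obtain p where p: "awalk x p y" "length p = gdist G x y" using gdist_walk[OF assms] .
  have "length (rev_path p) = length p" by (induction p) auto
  then show ?thesis using gdist_le[OF awalk_rev_path'[OF p(1)]] p(2) by simp
qed

lemma gdist_commute:
  assumes "awalk x q y"
  shows "gdist G x y = gdist G y x"
proof (rule antisym)
  show "gdist G y x \<le> gdist G x y" by (rule gdist_commute_le[OF assms])
  show "gdist G x y \<le> gdist G y x" by (rule gdist_commute_le[OF awalk_rev_path'[OF assms]])
qed

lemma gdist_Suc_le:
  assumes "awalk x q y" "(y, z) \<in> parcs G"
  shows "gdist G x z \<le> Suc (gdist G x y)"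
proof -
  obtain p where p: "awalk x p y" "length p = gdist G x y" using gdist_walk[OF assms(1)] .
  have a: "awalk y [(y, z)] z" using arc_implies_awalk[OF assms(2)] by simp
  have "gdist G x z \<le> length (p @ [(y, z)])"
    by (rule gdist_le[OF awalk_appendI[OF p(1) a]])
  then show ?thesis using p(2) by simp
qed

lemma gdist_eq_1_iff:
  assumes "awalk x q y"
  shows "gdist G x y = 1 \<longleftrightarrow> (x, y) \<in> parcs G"
proof
  assume "gdist G x y = 1"
  then obtain p where "awalk x p y" "length p = 1" using gdist_walk[OF assms] by metis
  then obtain e where "p = [e]" "awalk x [e] y" by (cases p) auto
  then show "(x, y) \<in> parcs G" by (cases e) (auto simp: awalk_simps)
next
  assume a: "(x, y) \<in> parcs G"
  then have "gdist G x y \<le> 1" using arc_implies_awalk[OF a] gdist_le[of x "[(x, y)]" y] by simp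
  moreover have "gdist G x y \<noteq> 0" using gdist_eq_0_D[OF assms] a no_loops' by blast
  ultimately show "gdist G x y = 1" by simp
qed

lemma gdist_predecessor:
  assumes "awalk x q y" "x \<noteq> y"
  obtains z where "(z, y) \<in> parcs G" "gdist G x y = Suc (gdist G x z)"
proof -
  obtain p where p: "awalk x p y" "length p = gdist G x y" using gdist_walk[OF assms(1)] .
  then have "p \<noteq> []" using assms(2) by (auto simp: awalk_Nil_iff)
  then obtain r e where r: "p = r @ [e]" by (cases p rule: rev_cases) auto
  obtain z w where e: "e = (z, w)" by (cases e)
  have walk: "awalk x r z" "(z, y) \<in> parcs G"
    using p(1) unfolding r e by (auto simp: awalk_simps)
  have "gdist G x z \<le> length r" by (rule gdist_le) (rule walk)
  moreover have "gdist G x y \<le> Suc (gdist G x z)" by (rule gdist_Suc_le[OF walk])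
  ultimately have "gdist G x y = Suc (gdist G x z)" using p(2) r by simp
  with walk(2) that show ?thesis by blast
qed

text \<open>If a shortest walk to \<open>w\<close> met \<open>y\<close>, its part up to
  \<open>y\<close> would be at least as long as the distance of \<open>y\<close> and so as the whole
  walk; nothing would remain and \<open>w\<close> would be \<open>y\<close>.\<close>

lemma short_walk_avoids:
  assumes "awalk x p w" "length p = gdist G x w" "gdist G x w \<le> gdist G x y" "w \<noteq> y"
  shows "y \<notin> set (pawalk_verts x p)"
proof
  assume "y \<in> set (pawalk_verts x p)"
  then obtain q r where qr: "p = q @ r" "awalk x q y" "awalk y r w"
    using awalk_decomp[OF assms(1), of y] by blast
  then have "gdist G x y \<le> length q" by (intro gdist_le)
  moreover have "length p = length q + length r" using qr(1) by simp
  ultimately have "length r = 0" using assms(2,3) by linarith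
  then have "r = []" by simp
  then show False using qr(3) assms(4) by (simp add: awalk_Nil_iff)
qed

text \<open>The two walks join \<open>z'\<close> to \<open>z\<close> through \<open>x\<close>
  without meeting \<open>y\<close>. A path extracted from them, closed by the two arcs at
  \<open>y\<close>, is the cycle; the path has an arc because of \<open>z \<noteq> z'\<close>, which
  makes at least three arcs in all.\<close>

lemma cycle_through_nbrs:
  assumes "awalk x p z" "awalk x p' z'" "y \<notin> set (pawalk_verts x p)" "y \<notin> set (pawalk_verts x p')"
    and "(z, y) \<in> parcs G" "(y, z') \<in> parcs G" "z \<noteq> z'"
  shows "\<exists>c. cycle c \<and> 3 \<le> length c"
proof -
  let ?w = "rev_path p' @ p"
  have w: "awalk z' (rev_path p') x" by (rule awalk_rev_path'[OF assms(2)])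
  have walk: "awalk z' ?w z" using awalk_appendI[OF w assms(1)] .
  have "set (pawalk_verts z' ?w) = set (pawalk_verts z' (rev_path p')) \<union> set (pawalk_verts x p)"
    using set_awalk_verts_append[OF w assms(1)] .
  then have y: "y \<notin> set (pawalk_verts z' ?w)"
    using assms(3,4) awalk_verts_rev_path[OF assms(2)] by simp
  let ?r = "awalk_to_apath ?w"
  have r: "apath z' ?r z" by (rule apath_awalk_to_apath[OF walk])
  then have rw: "awalk z' ?r z" by (rule awalkI_apath)
  have rne: "?r \<noteq> []" using rw assms(7) by (auto simp: awalk_Nil_iff)
  then have wne: "?w \<noteq> []" using awalk_to_apath_subset[OF walk] by auto
  have "set (pawalk_verts z' ?r) \<subseteq> set (pawalk_verts z' ?w)"
    using set_awalk_verts_not_Nil[OF rw rne] set_awalk_verts_not_Nil[OF walk wne]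
      awalk_to_apath_subset[OF walk] by auto
  then have y': "y \<notin> set (pawalk_verts z' ?r)" using y by blast
  let ?c = "(y, z') # ?r @ [(z, y)]"
  have "awalk z [(z, y)] y" using arc_implies_awalk[OF assms(5)] by simp
  then have ry: "awalk z' (?r @ [(z, y)]) y" by (rule awalk_appendI[OF rw])
  then have c: "awalk y ?c y" using assms(6) by (simp only: awalk_Cons_iff fst_conv snd_conv simp_thms)
  have "pawalk_verts z' (?r @ [(z, y)]) = pawalk_verts z' ?r @ [y]"
    using awalk_verts_append[OF ry] by simp
  then have "distinct (tl (pawalk_verts y ?c))"
    using r y' by (simp add: apath_def)
  then have "cycle ?c" using c unfolding cycle_def by blast
  moreover have "3 \<le> length ?c" using rne by (cases ?r) auto
  ultimately show ?thesis by blast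
qed

text \<open>The parent is the last vertex before \<open>y\<close> on a shortest walk. If another
  neighbour of \<open>y\<close> were no farther from \<open>x\<close> than \<open>y\<close>,
  shortest walks to both would avoid \<open>y\<close> and yield a cycle.\<close>

lemma tree_metric_gdist:
  assumes reach: "\<And>x y. x \<in> pverts G \<Longrightarrow> y \<in> pverts G \<Longrightarrow> \<exists>p. awalk x p y"
    and acyclic: "\<not> (\<exists>c. cycle c \<and> 3 \<le> length c)"
  shows "tree_metric (pverts G) (gdist G)"
proof
  show "finite (pverts G)" by (rule pair_finite_verts)
  fix x y assume xy: "x \<in> pverts G" "y \<in> pverts G"
  obtain q where q: "awalk x q y" using reach xy by blast
  show "gdist G x y = 0 \<longleftrightarrow> x = y"
    using gdist_eq_0_D[OF q] gdist_self xy by auto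
  show "gdist G x y = gdist G y x" by (rule gdist_commute[OF q])
  assume "x \<noteq> y"
  then obtain z where z: "(z, y) \<in> parcs G" "gdist G x y = Suc (gdist G x z)"
    using gdist_predecessor[OF q] by blast
  have zV: "z \<in> pverts G" using z in_arcsD1 by blast
  have adj: "gdist G y w = 1 \<longleftrightarrow> (y, w) \<in> parcs G" if "w \<in> pverts G" for w
    using reach[OF xy(2) that] gdist_eq_1_iff by blast
  have "gdist G x z' = Suc (gdist G x y)"
    if z': "z' \<in> pverts G" "gdist G y z' = 1" "z' \<noteq> z" for z'
  proof (rule ccontr)
    assume ne: "gdist G x z' \<noteq> Suc (gdist G x y)"
    have arc: "(y, z') \<in> parcs G" using adj z' by blast
    then have le: "gdist G x z' \<le> gdist G x y" using gdist_Suc_le[OF q arc] ne by simp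
    obtain p where p: "awalk x p z" "length p = gdist G x z"
      using reach[OF xy(1) zV] gdist_walk by blast
    obtain p' where p': "awalk x p' z'" "length p' = gdist G x z'"
      using reach[OF xy(1) z'(1)] gdist_walk by blast
    have "y \<notin> set (pawalk_verts x p)"
      by (rule short_walk_avoids[OF p]) (use z no_loops' in auto)
    moreover have "y \<notin> set (pawalk_verts x p')"
      by (rule short_walk_avoids[OF p' le]) (use arc no_loops' in auto)
    ultimately show False
      using cycle_through_nbrs[OF p(1) p'(1)] z(1) arc z'(3) acyclic by blast
  qed
  then show "\<exists>p\<in>pverts G. gdist G y p = 1 \<and> gdist G x y = Suc (gdist G x p) \<and>
      (\<forall>z\<in>pverts G. gdist G y z = 1 \<and> z \<noteq> p \<longrightarrow> gdist G x z = Suc (gdist G x y))"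
    using zV z adj[OF zV] arcs_symmetric by blast
qed

section \<open>From tree metrics back to trees\<close>

lemma pawalk_verts_nth:
  assumes "awalk u p v" "i < length p"
  shows "(pawalk_verts u p ! i, pawalk_verts u p ! Suc i) \<in> parcs G"
  using assms
proof (induction p arbitrary: u i)
  case (Cons e es)
  then have e: "e \<in> parcs G" "awalk (snd e) es v" by (auto simp: awalk_Cons_iff)
  show ?case
  proof (cases i)
    case 0
    have "pawalk_verts (snd e) es ! 0 = snd e"
      using awhd_of_awalk[OF e(2)] by (cases es) (auto simp: hd_conv_nth)
    then show ?thesis using 0 e by simp
  next
    case (Suc j)
    then show ?thesis using Cons.IH[OF e(2), of j] Cons.prems by simp
  qed
qed simp

text \<open>On the cycle, take a vertex farthest from the start \<open>u\<close>. Its two neighbours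
  on the cycle are no farther, so both are its parent and they coincide, against
  distinctness.\<close>

lemma acyclic_if_tree_metric:
  assumes tm: "tree_metric (pverts G) d"
    and adj: "\<And>x y. x \<in> pverts G \<Longrightarrow> y \<in> pverts G \<Longrightarrow> (x, y) \<in> parcs G \<longleftrightarrow> d x y = 1"
    and "cycle c"
  shows "length c < 3"
proof (rule ccontr)
  interpret T: tree_metric "pverts G" d by fact
  assume "\<not> length c < 3"
  then have l3: "3 \<le> length c" by simp
  obtain u where u: "awalk u c u" "distinct (tl (pawalk_verts u c))"
    using assms(3) unfolding cycle_def by blast
  define vs where "vs = pawalk_verts u c"
  define l where "l = length c"
  have len: "length vs = Suc l" using length_awalk_verts[of u c] by (simp add: vs_def l_def)
  have arc: "(vs ! i, vs ! Suc i) \<in> parcs G" if "i < l" for i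
    using pawalk_verts_nth[OF u(1)] that by (simp add: vs_def l_def)
  have uV: "u \<in> pverts G" using awalk_hd_in_verts[OF u(1)] .
  have inV: "vs ! i \<in> pverts G" if "i \<le> l" for i
  proof -
    have "set vs \<subseteq> pverts G" unfolding vs_def using u(1) by (rule awalkE')
    moreover have "vs ! i \<in> set vs" using that len by simp
    ultimately show ?thesis by blast
  qed
  have v0: "vs ! 0 = u"
    using awhd_of_awalk[OF u(1)] len by (simp add: vs_def hd_conv_nth)
  have "last vs = u" unfolding vs_def using u(1) by (rule awalkE')
  then have vl: "vs ! l = u" using len by (cases "vs = []") (simp_all add: last_conv_nth)
  have nbr: "d (vs ! i) (vs ! Suc i) = 1" if "i < l" for i
    using arc[OF that] adj inV[of i] inV[of "Suc i"] that by simp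
  let ?D = "(\<lambda>j. d u (vs ! j)) ` {..l}"
  have "Max ?D \<in> ?D" by (rule Max_in) auto
  then obtain i where i: "i \<le> l" and "Max ?D = d u (vs ! i)" by blast
  moreover have "d u (vs ! j) \<le> Max ?D" if "j \<le> l" for j
    by (rule Max_ge) (use that in auto)
  ultimately have i_max: "d u (vs ! j) \<le> d u (vs ! i)" if "j \<le> l" for j using that by simp
  have "1 \<le> l" "0 < l" using l3 unfolding l_def by linarith+
  then have "1 \<le> d u (vs ! i)" using i_max[of 1] nbr[of 0] v0 by simp
  then have "i \<noteq> 0" "i \<noteq> l" using v0 vl T.dist_self[OF uV] by (metis not_one_le_zero)+
  then obtain k where k: "i = Suc k" "Suc k < l" using i by (cases i) auto
  have lower: "d u (vs ! i) = Suc (d u w)" if "w \<in> pverts G" "d (vs ! i) w = 1" "d u w \<le> d u (vs ! i)" for w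
    using T.dist_nbr[OF uV inV[OF i] that(1,2)] that(3) by auto
  have eq: "vs ! k = vs ! Suc (Suc k)"
  proof (rule T.parent_unique[OF uV inV[OF i]])
    show 1: "vs ! k \<in> pverts G" "vs ! Suc (Suc k) \<in> pverts G" using inV k by auto
    show 2: "d (vs ! i) (vs ! k) = 1" "d (vs ! i) (vs ! Suc (Suc k)) = 1"
      using nbr[of k] nbr[of "Suc k"] k T.dist_commute inV by auto
    show "d u (vs ! i) = Suc (d u (vs ! k))" "d u (vs ! i) = Suc (d u (vs ! Suc (Suc k)))"
      using lower 1 2 i_max k by auto
  qed
  have neq: "vs ! Suc a \<noteq> vs ! Suc b" if "a < l" "b < l" "a \<noteq> b" for a b
    using nth_eq_iff_index_eq[of "tl vs" a b] u(2) len that by (simp add: nth_tl flip: vs_def)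
  show False
  proof (cases k)
    \<comment> \<open>Distinctness concerns the tail of \<open>vs\<close> and does not cover index
      0. The start is replaced by the equal vertex \<open>vs ! l\<close>, and
      \<open>3 \<le> l\<close> separates \<open>l\<close> from 2.\<close>
    case 0
    obtain l' where l': "l = Suc l'" using \<open>0 < l\<close> by (cases l) auto
    then have "vs ! Suc l' = vs ! Suc 1" using eq 0 v0 vl by simp
    then show False using neq[of l' 1] l' l3 by (simp add: l_def)
  next
    case (Suc k')
    then show False using eq neq[of k' "Suc k"] k by simp
  qed
qed

lemma reachable_if_tree_metric:
  assumes tm: "tree_metric (pverts G) d"
    and adj: "\<And>x y. x \<in> pverts G \<Longrightarrow> y \<in> pverts G \<Longrightarrow> (x, y) \<in> parcs G \<longleftrightarrow> d x y = 1"
    and "x \<in> pverts G" "y \<in> pverts G"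
  shows "x \<rightarrow>\<^sup>*\<^bsub>with_proj G\<^esub> y"
  using assms(4)
proof (induction "d x y" arbitrary: y)
  case 0
  then have "x = y" using tree_metric.dist_eq_0_iff[OF tm assms(3), of y] by simp
  then show ?case using assms(3) by simp
next
  case (Suc e)
  then have "x \<noteq> y" using tree_metric.dist_self[OF tm assms(3)] by auto
  then obtain p where p: "p \<in> pverts G" "d y p = 1" "d x y = Suc (d x p)"
    using tree_metric.parentE[OF tm assms(3) Suc.prems] by metis
  then have "x \<rightarrow>\<^sup>*\<^bsub>with_proj G\<^esub> p" using Suc by simp
  moreover have "(p, y) \<in> parcs G"
    using p adj[of p y] Suc.prems tree_metric.dist_commute[OF tm, of p y] by simp
  ultimately show ?case by (rule reachable_adj_trans)
qed

end

lemma undirected_tree_reach: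
  assumes "undirected_tree G" "x \<in> pverts G" "y \<in> pverts G"
  shows "\<exists>p. pre_digraph.awalk (with_proj G) x p y"
proof -
  interpret pair_graph G using assms by (simp add: undirected_tree_def)
  have "strongly_connected (with_proj G)"
    using assms(1) symmetric_connected_imp_strongly_connected[OF sym_arcs]
    by (simp add: undirected_tree_def)
  then have "x \<rightarrow>\<^sup>*\<^bsub>with_proj G\<^esub> y"
    using assms by (auto simp: strongly_connected_def)
  then show ?thesis by (simp add: reachable_awalk)
qed

lemma undirected_tree_tree_metric:
  assumes "undirected_tree G"
  shows "tree_metric (pverts G) (gdist G)"
proof -
  interpret pair_graph G using assms by (simp add: undirected_tree_def)
  show ?thesis
    by (rule tree_metric_gdist)
      (use undirected_tree_reach[OF assms] assms in \<open>auto simp: undirected_tree_def\<close>)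
qed

lemma undirected_tree_arc_iff:
  assumes "undirected_tree G" "x \<in> pverts G" "y \<in> pverts G"
  shows "(x, y) \<in> parcs G \<longleftrightarrow> gdist G x y = 1"
proof -
  interpret pair_graph G using assms by (simp add: undirected_tree_def)
  show ?thesis using undirected_tree_reach[OF assms] gdist_eq_1_iff by blast
qed

lemma undirected_tree_graph_dist:
  assumes "undirected_tree G" "x \<in> pverts G" "y \<in> pverts G"
  shows "graph_dist G x y = real (gdist G x y)"
proof -
  interpret pair_graph G using assms by (simp add: undirected_tree_def)
  show ?thesis using undirected_tree_reach[OF assms] graph_dist_eq_gdist by blast
qed

lemma undirected_treeI:
  assumes "pair_graph G" "pverts G \<noteq> {}" "tree_metric (pverts G) d"
    and adj: "\<And>x y. x \<in> pverts G \<Longrightarrow> y \<in> pverts G \<Longrightarrow> (x, y) \<in> parcs G \<longleftrightarrow> d x y = 1"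
  shows "undirected_tree G"
proof -
  interpret pair_graph G by fact
  have "strongly_connected (with_proj (mk_symmetric (with_proj G)))"
    unfolding strongly_connected_def
    using assms(2) reachable_if_tree_metric[OF assms(3) adj] reachable_mk_symmetricI by simp
  then have "Digraph_Component.connected (with_proj G)"
    unfolding Digraph_Component.connected_def .
  then show ?thesis
    unfolding undirected_tree_def
    using assms(1) acyclic_if_tree_metric[OF assms(3) adj] by (meson not_le)
qed

section \<open>The Harary index\<close>

context tree_metric
begin

lemma near_full:
  assumes "\<And>x y. x \<in> V \<Longrightarrow> y \<in> V \<Longrightarrow> d x y \<le> j"
  shows "near V d j = card V * card V"
proof -
  have "{(x, y) \<in> V \<times> V. d x y \<le> j} = V \<times> V" using assms by auto
  then show ?thesis by (simp add: near_def card_cartesian_product)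
qed

text \<open>Telescoping writes \<open>1 / e\<close> as the sum of \<open>1 / j - 1 / (j + 1)\<close>
  over \<open>e \<le> j < N\<close> plus \<open>1 / N\<close>. After an exchange of the sums, each
  \<open>j\<close> counts the pairs at distance at most \<open>j\<close> off the diagonal.\<close>

lemma sum_inverse_dist:
  assumes N: "\<And>x y. x \<in> V \<Longrightarrow> y \<in> V \<Longrightarrow> d x y \<le> N"
  shows "(\<Sum>(x, y) \<in> {(x, y). x \<in> V \<and> y \<in> V \<and> x \<noteq> y}. 1 / real (d x y)) =
    (\<Sum>j\<in>{1..<N}. (1 / real j - 1 / real (Suc j)) * (real (near V d j) - real (card V)))
      + (real (card V * card V) - real (card V)) / real N"
proof -
  let ?P = "{(x, y). x \<in> V \<and> y \<in> V \<and> x \<noteq> y}"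
  let ?g = "\<lambda>j. 1 / real j - 1 / real (Suc j)"
  have finP: "finite ?P" by (rule finite_subset[of _ "V \<times> V"]) (auto simp: finite_V)
  have card_near: "real (card {(x, y). x \<in> V \<and> y \<in> V \<and> x \<noteq> y \<and> d x y \<le> j}) = real (near V d j) - real (card V)" for j
  proof -
    let ?Q = "{(x, y). x \<in> V \<and> y \<in> V \<and> x \<noteq> y \<and> d x y \<le> j}" and ?I = "(\<lambda>x. (x, x)) ` V"
    have "{(x, y) \<in> V \<times> V. d x y \<le> j} = ?Q \<union> ?I" using dist_self by auto
    moreover have "card (?Q \<union> ?I) = card ?Q + card ?I"
    proof (rule card_Un_disjoint)
      show "finite ?Q" by (rule finite_subset[OF _ finP]) auto
    qed (auto simp: finite_V)
    moreover have "card ?I = card V" by (rule card_image) (auto intro: inj_onI)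
    ultimately show ?thesis by (simp add: near_def)
  qed
  have tele: "1 / real e = (\<Sum>j\<in>{j \<in> {1..<N}. e \<le> j}. ?g j) + 1 / real N" if "1 \<le> e" "e \<le> N" for e
  proof -
    have "{j \<in> {1..<N}. e \<le> j} = {e..<N}" using that by auto
    moreover have "(\<Sum>j\<in>{e..<N}. ?g j) = 1 / real e - 1 / real N"
      using sum_Suc_diff'[of e N "\<lambda>j. - (1 / real j)"] that by simp
    ultimately show ?thesis by simp
  qed
  have "(\<Sum>(x, y) \<in> ?P. 1 / real (d x y)) =
      (\<Sum>p\<in>?P. (\<Sum>j\<in>{j \<in> {1..<N}. d (fst p) (snd p) \<le> j}. ?g j) + 1 / real N)"
  proof (rule sum.cong[OF refl])
    fix p assume "p \<in> ?P"
    then obtain x y where p: "p = (x, y)" "x \<in> V" "y \<in> V" "x \<noteq> y" by auto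
    then have "d x y \<noteq> 0" using dist_eq_0_iff by simp
    then show "(case p of (x, y) \<Rightarrow> 1 / real (d x y)) =
        (\<Sum>j\<in>{j \<in> {1..<N}. d (fst p) (snd p) \<le> j}. ?g j) + 1 / real N"
      using tele[of "d x y"] N[of x y] p by simp
  qed
  also have "\<dots> = (\<Sum>p\<in>?P. \<Sum>j\<in>{j \<in> {1..<N}. d (fst p) (snd p) \<le> j}. ?g j) + real (card ?P) / real N"
    by (simp add: sum.distrib)
  also have "(\<Sum>p\<in>?P. \<Sum>j\<in>{j \<in> {1..<N}. d (fst p) (snd p) \<le> j}. ?g j) =
      (\<Sum>j\<in>{1..<N}. \<Sum>p\<in>{p \<in> ?P. d (fst p) (snd p) \<le> j}. ?g j)"
    by (rule sum.swap_restrict) (auto simp: finP)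
  also have "\<dots> = (\<Sum>j\<in>{1..<N}. ?g j * (real (near V d j) - real (card V)))"
  proof (rule sum.cong[OF refl])
    fix j
    have "{p \<in> ?P. d (fst p) (snd p) \<le> j} = {(x, y). x \<in> V \<and> y \<in> V \<and> x \<noteq> y \<and> d x y \<le> j}" by auto
    then have "real (card {p \<in> ?P. d (fst p) (snd p) \<le> j}) = real (near V d j) - real (card V)"
      using card_near by simp
    then show "(\<Sum>p\<in>{p \<in> ?P. d (fst p) (snd p) \<le> j}. ?g j) = ?g j * (real (near V d j) - real (card V))"
      by (simp only: sum_constant mult.commute)
  qed
  also have "real (card ?P) = real (card V * card V) - real (card V)"
  proof -
    have "?P = {(x, y). x \<in> V \<and> y \<in> V \<and> x \<noteq> y \<and> d x y \<le> N}" using N by auto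
    then show ?thesis using card_near[of N] near_full[OF N] by simp
  qed
  finally show ?thesis .
qed

text \<open>Leaves and vertices of degree two are disjoint and do not exhaust the tree: otherwise
  there would be just two leaves and \<open>q = card V - 2\<close>, against
  \<open>q + 4 \<le> card V\<close>.\<close>

lemma card_leaves_le:
  assumes "card {x \<in> V. deg V d x = 2} = q" "q + 4 \<le> card V"
  shows "card (leaves V d) \<le> card V - 1 - q"
proof -
  let ?D = "{x \<in> V. deg V d x = 2}"
  have cV: "2 \<le> card V" using assms by simp
  have disj: "leaves V d \<inter> ?D = {}" and sub: "leaves V d \<union> ?D \<subseteq> V"
    and fin: "finite (leaves V d)" "finite ?D"
    using finite_V by (auto simp: leaves_def)
  have cU: "card (leaves V d \<union> ?D) = card (leaves V d) + q"
    using card_Un_disjoint[OF fin disj] assms(1) by simp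
  have "leaves V d \<union> ?D \<noteq> V"
  proof
    assume eq: "leaves V d \<union> ?D = V"
    then have "(\<Sum>y\<in>V - leaves V d. int (deg V d y) - 2) = 0" by (intro sum.neutral) auto
    then have "card (leaves V d) = 2" using sum_excess[OF cV] by simp
    then show False using cU eq assms(2) by simp
  qed
  then have "card (leaves V d \<union> ?D) < card V"
    using sub finite_V by (intro psubset_card_mono) auto
  then show ?thesis using cU by simp
qed

end

lemma harary_eq:
  assumes "undirected_tree G"
    and "\<And>x y. x \<in> pverts G \<Longrightarrow> y \<in> pverts G \<Longrightarrow> gdist G x y \<le> N"
  shows "harary G = ((\<Sum>j\<in>{1..<N}. (1 / real j - 1 / real (Suc j)) *
      (real (near (pverts G) (gdist G) j) - real (card (pverts G))))
      + (real (card (pverts G) * card (pverts G)) - real (card (pverts G))) / real N) / 2"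
proof -
  have "(\<Sum>(x, y) \<in> {(x, y). x \<in> pverts G \<and> y \<in> pverts G \<and> x \<noteq> y}. 1 / graph_dist G x y) =
      (\<Sum>(x, y) \<in> {(x, y). x \<in> pverts G \<and> y \<in> pverts G \<and> x \<noteq> y}. 1 / real (gdist G x y))"
    by (rule sum.cong) (auto simp: undirected_tree_graph_dist[OF assms(1)])
  then show ?thesis
    using tree_metric.sum_inverse_dist[OF undirected_tree_tree_metric[OF assms(1)] assms(2)]
    by (simp add: harary_def)
qed

lemma gdist_bounded:
  assumes "undirected_tree G"
  shows "\<exists>N. \<forall>x\<in>pverts G. \<forall>y\<in>pverts G. gdist G x y \<le> N"
proof -
  interpret tree_metric "pverts G" "gdist G" using undirected_tree_tree_metric[OF assms] .
  obtain j where "\<forall>x\<in>pverts G. disc (pverts G) (gdist G) x j = pverts G" using disc_eq_V by blast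
  then show ?thesis unfolding disc_def by blast
qed

text \<open>The coefficients of \<open>near\<close> are positive, so equality of the sums forces
  equality of the terms. For \<open>j = 0\<close> and for \<open>N \<le> j\<close>, outside the
  range of the sum, the number of vertices alone determines \<open>near\<close>.\<close>

lemma harary_mono:
  assumes "undirected_tree G" "undirected_tree H" "card (pverts G) = card (pverts H)"
    and le: "\<And>j. near (pverts G) (gdist G) j \<le> near (pverts H) (gdist H) j"
  shows "harary G \<le> harary H"
    and "harary G = harary H \<Longrightarrow> near (pverts G) (gdist G) j = near (pverts H) (gdist H) j"
proof -
  obtain N1 N2 where N: "\<forall>x\<in>pverts G. \<forall>y\<in>pverts G. gdist G x y \<le> N1"
    "\<forall>x\<in>pverts H. \<forall>y\<in>pverts H. gdist H x y \<le> N2"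
    using gdist_bounded assms(1,2) by metis
  define N where "N = N1 + N2"
  have NG: "\<And>x y. x \<in> pverts G \<Longrightarrow> y \<in> pverts G \<Longrightarrow> gdist G x y \<le> N"
    and NH: "\<And>x y. x \<in> pverts H \<Longrightarrow> y \<in> pverts H \<Longrightarrow> gdist H x y \<le> N"
    using N by (auto simp: N_def intro: trans_le_add1 trans_le_add2)
  let ?n = "real (card (pverts H))"
  let ?f = "\<lambda>j. (1 / real j - 1 / real (Suc j)) * (real (near (pverts G) (gdist G) j) - ?n)"
  let ?g = "\<lambda>j. (1 / real j - 1 / real (Suc j)) * (real (near (pverts H) (gdist H) j) - ?n)"
  have pos: "0 < 1 / real j - 1 / real (Suc j)" if "j \<in> {1..<N}" for j
    using frac_less2[of 1 1 "real j" "real (Suc j)"] that by simp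
  have fg: "?f j \<le> ?g j" if "j \<in> {1..<N}" for j
    using pos[OF that] le[of j] by (intro mult_left_mono) auto
  have eqs: "harary G = (sum ?f {1..<N} + (?n * ?n - ?n) / real N) / 2"
    "harary H = (sum ?g {1..<N} + (?n * ?n - ?n) / real N) / 2"
    using harary_eq[OF assms(1) NG] harary_eq[OF assms(2) NH] assms(3) by simp_all
  have "sum ?f {1..<N} \<le> sum ?g {1..<N}" by (rule sum_mono) (rule fg)
  then show "harary G \<le> harary H" using eqs by simp
  assume "harary G = harary H"
  then have sum_eq: "sum ?f {1..<N} = sum ?g {1..<N}" using eqs by simp
  consider "j = 0" | "j \<in> {1..<N}" | "N \<le> j" by fastforce
  then show "near (pverts G) (gdist G) j = near (pverts H) (gdist H) j"
  proof cases
    case 1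
    then show ?thesis
      using tree_metric.near_0[OF undirected_tree_tree_metric] assms by metis
  next
    case 2
    have "?f j = ?g j"
    proof (rule ccontr)
      assume "?f j \<noteq> ?g j"
      with fg[OF 2] have "?f j < ?g j" by (rule le_neq_trans)
      then have "\<exists>j\<in>{1..<N}. ?f j < ?g j" using 2 by blast
      moreover have "\<forall>j\<in>{1..<N}. ?f j \<le> ?g j" using fg by blast
      ultimately have "sum ?f {1..<N} < sum ?g {1..<N}" by (intro sum_strict_mono_ex1) blast+
      then show False using sum_eq by simp
    qed
    then show ?thesis using pos[OF 2] by simp
  next
    case 3
    have "near (pverts G) (gdist G) j = card (pverts G) * card (pverts G)"
      by (rule tree_metric.near_full[OF undirected_tree_tree_metric[OF assms(1)]])
        (use NG 3 in \<open>blast intro: order_trans\<close>)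
    moreover have "near (pverts H) (gdist H) j = card (pverts H) * card (pverts H)"
      by (rule tree_metric.near_full[OF undirected_tree_tree_metric[OF assms(2)]])
        (use NH 3 in \<open>blast intro: order_trans\<close>)
    ultimately show ?thesis using assms(3) by simp
  qed
qed

section \<open>Graph isomorphisms\<close>

lemma near_bij_betw:
  assumes "bij_betw h V W" "\<And>x y. x \<in> V \<Longrightarrow> y \<in> V \<Longrightarrow> d x y = d' (h x) (h y)"
  shows "near V d j = near W d' j"
proof -
  let ?h = "\<lambda>(x, y). (h x, h y)"
  have inj: "inj_on ?h {(x, y) \<in> V \<times> V. d x y \<le> j}"
    using assms(1) by (auto simp: inj_on_def bij_betw_def)
  have "?h ` {(x, y) \<in> V \<times> V. d x y \<le> j} = {(x, y) \<in> W \<times> W. d' x y \<le> j}"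
  proof (intro equalityI subsetI)
    fix z assume "z \<in> {(x, y) \<in> W \<times> W. d' x y \<le> j}"
    then obtain x y where "z = (h x, h y)" "x \<in> V" "y \<in> V" "d' (h x) (h y) \<le> j"
      using assms(1) by (auto simp: bij_betw_def)
    then show "z \<in> ?h ` {(x, y) \<in> V \<times> V. d x y \<le> j}" using assms(2) by force
  qed (use assms in \<open>auto simp: bij_betw_def\<close>)
  then show ?thesis unfolding near_def using card_image[OF inj] by simp
qed

lemma digraph_isoI:
  assumes "pair_wf_digraph G" "pair_wf_digraph H" "bij_betw h (pverts G) (pverts H)"
    and arc: "\<And>x y. x \<in> pverts G \<Longrightarrow> y \<in> pverts G \<Longrightarrow> (x, y) \<in> parcs G \<longleftrightarrow> (h x, h y) \<in> parcs H"
  shows "digraph_iso (with_proj G) (with_proj H)"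
proof -
  interpret G: pair_wf_digraph G by fact
  interpret H: pair_wf_digraph H by fact
  let ?f = "\<lparr>iso_verts = h, iso_arcs = (\<lambda>(x, y). (h x, h y)), iso_head = snd, iso_tail = fst\<rparr>"
  have inj: "inj_on h (pverts G)" and img: "h ` pverts G = pverts H"
    using assms(3) by (auto simp: bij_betw_def)
  have "inj_on (\<lambda>(x, y). (h x, h y)) (parcs G)"
    using inj by (auto simp: inj_on_def dest: G.in_arcsD1 G.in_arcsD2)
  then have "pre_digraph.digraph_isomorphism (with_proj G) ?f"
    unfolding pre_digraph.digraph_isomorphism_def
    using inj G.wf_digraph by auto
  moreover have "(\<lambda>(x, y). (h x, h y)) ` parcs G = parcs H"
  proof (intro equalityI subsetI)
    fix z assume z: "z \<in> parcs H"
    obtain a b where ab: "z = (a, b)" by (cases z)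
    then have "a \<in> h ` pverts G" "b \<in> h ` pverts G"
      using z H.in_arcsD1 H.in_arcsD2 unfolding img by blast+
    then obtain x y where "x \<in> pverts G" "y \<in> pverts G" "a = h x" "b = h y" by blast
    then show "z \<in> (\<lambda>(x, y). (h x, h y)) ` parcs G" using z ab arc by force
  next
    fix z assume "z \<in> (\<lambda>(x, y). (h x, h y)) ` parcs G"
    then obtain x y where xy: "(x, y) \<in> parcs G" "z = (h x, h y)" by auto
    then show "z \<in> parcs H" using arc[OF G.in_arcsD1[OF xy(1)] G.in_arcsD2[OF xy(1)]] by simp
  qed
  then have "with_proj H = app_iso ?f (with_proj G)"
    by (simp add: app_iso_def with_proj_def img)
  ultimately show ?thesis unfolding digraph_iso_def by blast
qed

text \<open>The metric of \<open>H\<close>, pulled back along the isomorphism, has the adjacency of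
  \<open>G\<close> and hence is the metric of \<open>G\<close>.\<close>

lemma digraph_iso_near_eq:
  assumes "undirected_tree G" "undirected_tree H" "digraph_iso (with_proj G) (with_proj H)"
  shows "near (pverts G) (gdist G) j = near (pverts H) (gdist H) j"
proof -
  obtain f where f: "pre_digraph.digraph_isomorphism (with_proj G) f" "with_proj H = app_iso f (with_proj G)"
    using assms(3) by (auto simp: digraph_iso_def)
  interpret G: pair_graph G using assms(1) by (simp add: undirected_tree_def)
  let ?h = "iso_verts f"
  have "pverts H = ?h ` pverts G"
    using arg_cong[OF f(2), of verts] by simp
  then have bij: "bij_betw ?h (pverts G) (pverts H)"
    using f(1) by (simp add: bij_betw_def pre_digraph.digraph_isomorphism_def)
  have arcs: "parcs H = (\<lambda>(u, v). (?h u, ?h v)) ` parcs G"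
    using G.arcs_ends_app_iso_eq[OF f(1)] unfolding f(2)[symmetric] with_proj_simps(3) .
  have hV: "?h x \<in> pverts H" if "x \<in> pverts G" for x using bij that by (auto simp: bij_betw_def)
  have arc: "(x, y) \<in> parcs G \<longleftrightarrow> (?h x, ?h y) \<in> parcs H" if "x \<in> pverts G" "y \<in> pverts G" for x y
  proof
    assume "(?h x, ?h y) \<in> parcs H"
    then obtain u v where uv: "(u, v) \<in> parcs G" "?h x = ?h u" "?h y = ?h v" using arcs by auto
    then have "x = u" "y = v"
      using bij that G.in_arcsD1[OF uv(1)] G.in_arcsD2[OF uv(1)]
      by (auto simp: bij_betw_def inj_on_def)
    then show "(x, y) \<in> parcs G" using uv by simp
  qed (use arcs in force)
  have "gdist G x y = gdist H (?h x) (?h y)" if "x \<in> pverts G" "y \<in> pverts G" for x y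
  proof (rule tree_metric_unique[OF undirected_tree_tree_metric[OF assms(1)]
        tree_metric_vimage[OF undirected_tree_tree_metric[OF assms(2)] bij] _ that])
    fix x y assume xy: "x \<in> pverts G" "y \<in> pverts G"
    show "gdist G x y = 1 \<longleftrightarrow> gdist H (?h x) (?h y) = 1"
      using undirected_tree_arc_iff[OF assms(1) xy] undirected_tree_arc_iff[OF assms(2) hV hV] arc xy
      by blast
  qed
  then show ?thesis by (rule near_bij_betw[OF bij])
qed

lemma num_degree_two_eq:
  assumes "pair_graph G"
    and "\<And>x y. x \<in> pverts G \<Longrightarrow> y \<in> pverts G \<Longrightarrow> (x, y) \<in> parcs G \<longleftrightarrow> d x y = 1"
  shows "num_degree_two G = card {x \<in> pverts G. deg (pverts G) d x = 2}"
proof -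
  interpret pair_graph G by fact
  have "out_degree (with_proj G) x = deg (pverts G) d x" if "x \<in> pverts G" for x
  proof -
    have "out_arcs (with_proj G) x = Pair x ` nbrs (pverts G) d x"
    proof (intro equalityI subsetI)
      fix e assume "e \<in> out_arcs (with_proj G) x"
      then obtain y where e: "(x, y) \<in> parcs G" "e = (x, y)" by (cases e) (auto simp: out_arcs_def)
      then show "e \<in> Pair x ` nbrs (pverts G) d x"
        using assms(2)[OF that in_arcsD2[OF e(1)]] in_arcsD2[OF e(1)] by (simp add: nbrs_def)
    qed (use assms(2) that in \<open>auto simp: out_arcs_def nbrs_def\<close>)
    then show ?thesis
      unfolding out_degree_def deg_def by (simp add: card_image inj_on_def)
  qed
  then show ?thesis unfolding num_degree_two_def by (metis (mono_tags, lifting))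
qed

section \<open>Starlike trees as graphs\<close>

lemma pverts_starlike: "pverts (starlike k l) = sverts k l"
  by (simp add: starlike_def sverts_def)

lemma parcs_starlike_iff:
  assumes "x \<in> sverts k l" "y \<in> sverts k l"
  shows "(x, y) \<in> parcs (starlike k l) \<longleftrightarrow> sdist x y = 1"
proof (cases x)
  case None
  then show ?thesis using assms
    by (cases y) (auto simp: starlike_def starlike_arcs_def)
next
  case (Some ij)
  obtain i j where x: "x = Some (i, j)" using Some by (cases ij) auto
  show ?thesis using assms unfolding x sdist_eq_1_iff
    by (cases y) (auto simp: starlike_def starlike_arcs_def)
qed

lemma pair_graph_starlike: "pair_graph (starlike k l)"
proof
  have arcs: "parcs (starlike k l) \<subseteq> sverts k l \<times> sverts k l"
    by (auto simp: starlike_def starlike_arcs_def)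
  then show "fst e \<in> pverts (starlike k l)" "snd e \<in> pverts (starlike k l)"
    if "e \<in> parcs (starlike k l)" for e
    using that by (auto simp: pverts_starlike)
  show "finite (pverts (starlike k l))" by (simp add: pverts_starlike)
  show "finite (parcs (starlike k l))" by (rule finite_subset[OF arcs]) simp
  show "fst e \<noteq> snd e" if "e \<in> parcs (starlike k l)" for e
    using that by (auto simp: starlike_def starlike_arcs_def)
  show "symmetric (with_proj (starlike k l))"
    by (auto simp: symmetric_def starlike_def sym_def)
qed

lemma undirected_tree_starlike: "undirected_tree (starlike k l)"
proof (rule undirected_treeI[OF pair_graph_starlike])
  show "pverts (starlike k l) \<noteq> {}" by (auto simp: pverts_starlike sverts_def)
  show "tree_metric (pverts (starlike k l)) sdist"
    unfolding pverts_starlike by (rule tree_metric_starlike)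
qed (simp add: parcs_starlike_iff pverts_starlike)

lemma near_starlike: "near (pverts (starlike k l)) (gdist (starlike k l)) j = near (sverts k l) sdist j"
proof -
  let ?V = "pverts (starlike k l)"
  have "gdist (starlike k l) x y = sdist x y" if "x \<in> ?V" "y \<in> ?V" for x y
  proof (rule tree_metric_unique[OF undirected_tree_tree_metric[OF undirected_tree_starlike] _ _ that])
    show "tree_metric ?V sdist" unfolding pverts_starlike by (rule tree_metric_starlike)
    show "gdist (starlike k l) x y = 1 \<longleftrightarrow> sdist x y = 1" if "x \<in> ?V" "y \<in> ?V" for x y
      using undirected_tree_arc_iff[OF undirected_tree_starlike that] parcs_starlike_iff that
      unfolding pverts_starlike by blast
  qed
  then have "{(x, y) \<in> ?V \<times> ?V. gdist (starlike k l) x y \<le> j} = {(x, y) \<in> ?V \<times> ?V. sdist x y \<le> j}"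
    by auto
  then show ?thesis by (simp add: near_def pverts_starlike)
qed

text \<open>The vertices of degree two are those that are neither leaf nor centre;
  \<open>3 \<le> k\<close> keeps the degree of the centre from being 2.\<close>

lemma num_degree_two_BS:
  assumes "3 \<le> k" "k + 1 \<le> n"
  shows "num_degree_two (BS n k) = n - 1 - k"
proof -
  interpret balanced_starlike k "branch_size n k" "height n k"
    using assms by (intro balanced_starlike_BS) auto
  have "num_degree_two (BS n k) = card {x \<in> S. deg S sdist x = 2}"
    unfolding BS_def using num_degree_two_eq[OF pair_graph_starlike] parcs_starlike_iff
    by (simp add: pverts_starlike)
  also have "{x \<in> S. deg S sdist x = 2} = S - leaves S sdist - {None}"
    using nonleaf_deg deg_None assms by (auto simp: leaves_def)
  also have "card \<dots> = card S - card (leaves S sdist) - 1"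
  proof -
    have "None \<in> S - leaves S sdist" by (auto simp: leaves_eq)
    moreover have "card (S - leaves S sdist) = card S - card (leaves S sdist)"
      by (rule card_Diff_subset) (auto simp: leaves_def)
    ultimately show ?thesis by simp
  qed
  also have "card (leaves S sdist) = k"
    unfolding leaves_eq by (subst card_image) (auto intro: inj_onI)
  finally show ?thesis using card_bsverts[of k n] assms by simp
qed

theorem theorem3p2:
  fixes n q :: nat
  assumes "q + 4 \<le> n"
  shows "undirected_tree (BS n (n - 1 - q)) \<and>
         card (pverts (BS n (n - 1 - q))) = n \<and>
         num_degree_two (BS n (n - 1 - q)) = q \<and>
         (\<forall>T :: 'a pair_pre_digraph.
            undirected_tree T \<and> card (pverts T) = n \<and> num_degree_two T = q \<longrightarrow>
            harary T \<le> harary (BS n (n - 1 - q)) \<and>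
            (harary T = harary (BS n (n - 1 - q)) \<longleftrightarrow>
             digraph_iso (with_proj T) (with_proj (BS n (n - 1 - q)))))"
proof -
  define k where "k = n - 1 - q"
  have k: "3 \<le> k" "k + 1 \<le> n" using assms by (auto simp: k_def)
  have tree: "undirected_tree (BS n k)" unfolding BS_def by (rule undirected_tree_starlike)
  have pv: "pverts (BS n k) = bsverts n k" unfolding BS_def by (rule pverts_starlike)
  have card: "card (pverts (BS n k)) = n" unfolding pv using k by (simp add: card_bsverts)
  have near_BS: "near (pverts (BS n k)) (gdist (BS n k)) j = near (bsverts n k) sdist j" for j
    unfolding BS_def by (rule near_starlike)
  have main: "harary T \<le> harary (BS n k) \<and>
      (harary T = harary (BS n k) \<longleftrightarrow> digraph_iso (with_proj T) (with_proj (BS n k)))"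
    if T: "undirected_tree T" "card (pverts T) = n" "num_degree_two T = q" for T :: "'a pair_pre_digraph"
  proof -
    interpret T: tree_metric "pverts T" "gdist T" using undirected_tree_tree_metric[OF T(1)] .
    have pg: "pair_graph T" using T(1) by (simp add: undirected_tree_def)
    have "card {x \<in> pverts T. deg (pverts T) (gdist T) x = 2} = q"
      using num_degree_two_eq[OF pg undirected_tree_arc_iff[OF T(1)]] T(3) by simp
    then have leaves: "card (leaves (pverts T) (gdist T)) \<le> k"
      using T.card_leaves_le assms T(2) by (simp add: k_def)
    have "pverts T \<noteq> {}" using T(2) assms by auto
    then have le: "near (pverts T) (gdist T) j \<le> near (pverts (BS n k)) (gdist (BS n k)) j" for j
      using near_le_near_BS[OF T.tree_metric_axioms _ leaves, of j] k T(2) by (simp add: near_BS)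
    have cards: "card (pverts T) = card (pverts (BS n k))" using T(2) card by simp
    note mono = harary_mono[OF T(1) tree cards le]
    have "digraph_iso (with_proj T) (with_proj (BS n k))" if eq: "harary T = harary (BS n k)"
    proof -
      have near: "near (pverts T) (gdist T) j = near (bsverts (card (pverts T)) k) sdist j" for j
        using mono(2)[OF eq] T(2) by (simp add: near_BS)
      obtain h where h: "bij_betw h (pverts T) (bsverts n k)"
        "\<And>x y. x \<in> pverts T \<Longrightarrow> y \<in> pverts T \<Longrightarrow> gdist T x y = 1 \<longleftrightarrow> sdist (h x) (h y) = 1"
        using near_eq_imp_isomorphic_to_BS[OF T.tree_metric_axioms k(1) _ leaves near] k(2) T(2) by blast
      interpret pair_graph T by (rule pg)
      interpret B: pair_graph "BS n k" unfolding BS_def by (rule pair_graph_starlike)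
      have hV: "h x \<in> bsverts n k" if "x \<in> pverts T" for x using h(1) that by (auto simp: bij_betw_def)
      show ?thesis
      proof (rule digraph_isoI)
        show "bij_betw h (pverts T) (pverts (BS n k))" using h(1) pv by simp
        show "(x, y) \<in> parcs T \<longleftrightarrow> (h x, h y) \<in> parcs (BS n k)"
          if "x \<in> pverts T" "y \<in> pverts T" for x y
          using undirected_tree_arc_iff[OF T(1) that] h(2)[OF that]
            parcs_starlike_iff[OF hV[OF that(1)] hV[OF that(2)]] unfolding BS_def by blast
      qed unfold_locales
    qed
    moreover have "harary T = harary (BS n k)" if iso: "digraph_iso (with_proj T) (with_proj (BS n k))"
    proof (rule antisym)
      show "harary T \<le> harary (BS n k)" by (rule mono(1))
      \<comment> \<open>Isomorphic trees have the same \<open>near\<close>, so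
        \<open>harary_mono\<close> applies in the reverse direction as well.\<close>
      show "harary (BS n k) \<le> harary T"
        using harary_mono(1)[OF tree T(1)] cards digraph_iso_near_eq[OF T(1) tree iso] by simp
    qed
    ultimately show ?thesis using mono(1) by blast
  qed
  moreover have "num_degree_two (BS n k) = q"
    using num_degree_two_BS[OF k] assms by (simp add: k_def)
  ultimately show ?thesis using tree card unfolding k_def by blast
qed

end
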